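(* Let $\mathcal G$ be a playerwise connected $k$-player game (any $k$, any finite question and answer sets) such that $\mathrm{val}(\mathcal G)<1$. Then there exists a constant $c=c(\mathcal G)>0$ such that for every $n\in\mathbb N$, $\mathrm{val}(\mathcal G^{\otimes n})\le n^{-c}$.
   Context: A $k$-player game $\mathcal G=(\mathcal X,\mathcal A,Q,V)$ has finite question set $\mathcal X=\mathcal X^1\times\dots\times\mathcal X^k$, finite answer set $\mathcal A=\mathcal A^1\times\dots\times\mathcal A^k$, distribution $Q$ on $\mathcal X$ and predicate $V:\mathcal X\times\mathcal A\to\{0,1\}$; its value is the maximum over deterministic strategies $f^j:\mathcal X^j\to\mathcal A^j$ of $\Pr_{x\sim Q}[V(x,(f^j(x^j))_j)=1]$. The $n$-fold repetition $\mathcal G^{\otimes n}$ draws $n$ i.i.d. question tuples from $Q$, player $j$ gets its $n$ questions and gives $n$ answers, and the players win iff $V$ holds in all coordinates. Let $\mathcal S$ be the support of $Q$, and assume (as part of the definition) that for every $j$ every $x^j\in\mathcal X^j$ is given to player $j$ with positive probability. For $j\in[k]$, $H^j_{\mathcal G}$ is the graph on vertex set $\mathcal X^j$ with an edge between $x^j\neq y^j$ iff there exists $x^{-j}$ (questions for the other players) such that both $(x^{-j},x^j)\in\mathcal S$ and $(x^{-j},y^j)\in\mathcal S$. The game is playerwise connected if $H^j_{\mathcal G}$ is connected for every $j\in[k]$. *)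

theory Defs
  imports "HOL-Probability.Probability" "Graph_Theory.Digraph_Component"
begin

text \<open>
  The players are \<open>0, \<dots>, k - 1\<close>. Question and answer tuples are extensional functions on
  \<open>{..<k}\<close>. The players have individual question sets and answer sets, taken inside one common
  type each; as all these sets are finite, this is no restriction.
\<close>

record ('q, 'a) game =
  players :: nat
  questions :: "nat \<Rightarrow> 'q set"
  answers :: "nat \<Rightarrow> 'a set"
  distr_questions :: "(nat \<Rightarrow> 'q) pmf"
  wins :: "(nat \<Rightarrow> 'q) \<Rightarrow> (nat \<Rightarrow> 'a) \<Rightarrow> bool"

definition question_support :: "('q, 'a) game \<Rightarrow> (nat \<Rightarrow> 'q) set" where
  "question_support G = set_pmf (distr_questions G)"

locale finite_game =
  fixes G :: "('q, 'a) game"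
  assumes finite_questions: "\<And>j. j < players G \<Longrightarrow> finite (questions G j)"
    and finite_answers: "\<And>j. j < players G \<Longrightarrow> finite (answers G j)"
    and answers_nonempty: "\<And>j. j < players G \<Longrightarrow> answers G j \<noteq> {}"
    and question_support_subset: "question_support G \<subseteq> Pi\<^sub>E {..<players G} (questions G)"
    and question_prob_pos: "\<And>j q. j < players G \<Longrightarrow> q \<in> questions G j \<Longrightarrow>
      measure_pmf.prob (distr_questions G) {x. x j = q} > 0"

definition strategies :: "('q, 'a) game \<Rightarrow> (nat \<Rightarrow> 'q \<Rightarrow> 'a) set" where
  "strategies G = (\<Pi>\<^sub>E j\<in>{..<players G}. questions G j \<rightarrow>\<^sub>E answers G j)"

definition win_prob :: "('q, 'a) game \<Rightarrow> (nat \<Rightarrow> 'q \<Rightarrow> 'a) \<Rightarrow> real" where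
  "win_prob G f = measure_pmf.prob (distr_questions G)
     {x. wins G x (\<lambda>j\<in>{..<players G}. f j (x j))}"

definition game_value :: "('q, 'a) game \<Rightarrow> real" where
  "game_value G = Max (win_prob G ` strategies G)"

text \<open>
  The \<open>n\<close> question tuples \<open>xs 0, \<dots>, xs (n - 1)\<close> are drawn independently and then transposed, so
  that player \<open>j\<close> gets the vector \<open>(xs 0 j, \<dots>, xs (n - 1) j)\<close> as a single question of the
  repeated game.
\<close>

definition repeated_game :: "('q, 'a) game \<Rightarrow> nat \<Rightarrow> (nat \<Rightarrow> 'q, nat \<Rightarrow> 'a) game" where
  "repeated_game G n = \<lparr>
     players = players G,
     questions = (\<lambda>j. {..<n} \<rightarrow>\<^sub>E questions G j),
     answers = (\<lambda>j. {..<n} \<rightarrow>\<^sub>E answers G j),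
     distr_questions = map_pmf (\<lambda>xs. \<lambda>j\<in>{..<players G}. \<lambda>i\<in>{..<n}. xs i j)
       (Pi_pmf {..<n} undefined (\<lambda>_. distr_questions G)),
     wins = (\<lambda>x a. \<forall>i<n. wins G (\<lambda>j\<in>{..<players G}. x j i) (\<lambda>j\<in>{..<players G}. a j i))\<rparr>"

text \<open>
  In \<open>x(j := q)\<close> only the entries of \<open>x\<close> at the players other than \<open>j\<close> matter. An undirected
  edge is represented by its two opposite arcs.
\<close>

definition question_graph :: "('q, 'a) game \<Rightarrow> nat \<Rightarrow> 'q pair_pre_digraph" where
  "question_graph G j = \<lparr>
     pverts = questions G j,
     parcs = {(q, q'). q \<in> questions G j \<and> q' \<in> questions G j \<and> q \<noteq> q' \<and>
       (\<exists>x. x(j := q) \<in> question_support G \<and> x(j := q') \<in> question_support G)}\<rparr>"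

definition playerwise_connected :: "('q, 'a) game \<Rightarrow> bool" where
  "playerwise_connected G \<longleftrightarrow>
     (\<forall>j<players G. Digraph_Component.connected (with_proj (question_graph G j)))"

lemma (in finite_game) pair_graph_question_graph:
  assumes "j < players G"
  shows "pair_graph (question_graph G j)"
proof -
  have "finite (parcs (question_graph G j))"
    by (rule finite_subset[of _ "questions G j \<times> questions G j"])
      (use assms finite_questions in \<open>auto simp: question_graph_def\<close>)
  moreover have "sym (parcs (question_graph G j))"
    by (auto simp: sym_def question_graph_def)
  ultimately show ?thesis
    using assms finite_questions
    by unfold_locales (auto simp: question_graph_def symmetric_def)
qed

lemma (in finite_game) finite_game_repeated: "finite_game (repeated_game G n)"
proof
  let ?P = "Pi_pmf {..<n} undefined (\<lambda>_. distr_questions G)"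
  let ?t = "\<lambda>xs. \<lambda>j\<in>{..<players G}. \<lambda>i\<in>{..<n}. xs i j"
  have supp: "set_pmf ?P = ({..<n} \<rightarrow>\<^sub>E question_support G)"
    by (auto simp: set_Pi_pmf question_support_def PiE_dflt_def PiE_def extensional_def Pi_def)
  have supp': "question_support (repeated_game G n) = ?t ` ({..<n} \<rightarrow>\<^sub>E question_support G)"
    unfolding question_support_def[of "repeated_game G n"]
    by (simp add: repeated_game_def supp)
  show "question_support (repeated_game G n)
      \<subseteq> Pi\<^sub>E {..<players (repeated_game G n)} (questions (repeated_game G n))"
    using question_support_subset unfolding supp'
    by (fastforce simp: repeated_game_def PiE_iff)
  fix j assume j: "j < players (repeated_game G n)"
  then have j': "j < players G" by (simp add: repeated_game_def)
  show "finite (questions (repeated_game G n) j)" "finite (answers (repeated_game G n) j)"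
    "answers (repeated_game G n) j \<noteq> {}"
    using j' finite_questions finite_answers answers_nonempty
    by (auto simp: repeated_game_def finite_PiE PiE_eq_empty_iff)
  fix q assume "q \<in> questions (repeated_game G n) j"
  then have q: "q \<in> {..<n} \<rightarrow>\<^sub>E questions G j" by (simp add: repeated_game_def)
  have "\<exists>x\<in>question_support G. x j = q i" if "i < n" for i
  proof (rule ccontr)
    assume "\<not> ?thesis"
    then have "measure_pmf.prob (distr_questions G) {x. x j = q i} = 0"
      by (auto simp: measure_pmf_zero_iff question_support_def)
    with question_prob_pos[OF j', of "q i"] q that show False by auto
  qed
  then obtain y where y: "\<And>i. i < n \<Longrightarrow> y i \<in> question_support G \<and> y i j = q i" by metis
  define xs where "xs = (\<lambda>i\<in>{..<n}. y i)"
  have "xs \<in> {..<n} \<rightarrow>\<^sub>E question_support G" using y by (auto simp: xs_def)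
  moreover have "?t xs j = q"
    using q y j' by (auto simp: xs_def fun_eq_iff PiE_def extensional_def)
  ultimately have "?t xs \<in> question_support (repeated_game G n) \<inter> {x. x j = q}"
    unfolding supp' by blast
  then show "measure_pmf.prob (distr_questions (repeated_game G n)) {x. x j = q} > 0"
    unfolding question_support_def by (blast intro: measure_pmf_posI)
qed

end

theory Submission
  imports Defs "HOL-Real_Asymp.Real_Asymp"
begin

text \<open>
  For player \<open>j\<close> let \<open>P\<close> be the conditional expectation given the questions of the other players.
  Connectivity of the question graph is a Poincare inequality: in one coordinate, a function \<open>f\<close> of
  the question of player \<open>j\<close> has variance at most \<open>C\<close> times the squared norm of \<open>f - P f\<close>.
  Telescoping over the coordinates, \<open>P F\<close> has total influence at most \<open>C\<close> for every \<open>[0, 1]\<close>-valued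
  function \<open>F\<close> of the question vector of player \<open>j\<close>. Hence in the expectation of a product over the
  players of such functions each factor may be averaged over a set \<open>J\<close> of coordinates, at a cost
  governed by these influences in \<open>J\<close>.

  Let \<open>D\<close> be a product event (one event per player), and apply this to the functions ``player \<open>j\<close>
  is in \<open>D\<close>, is asked \<open>u\<close> and answers \<open>b\<close> in coordinate \<open>i\<close>''. Averaged over \<open>J\<close>, with the other
  coordinates fixed, they form a randomised strategy for one copy of the game, scaled by the
  average over \<open>J\<close> of the indicator of the event of player \<open>j\<close>. If \<open>i\<close> and \<open>J\<close> are taken from a
  colour class of a suitable colouring of the coordinates with about \<open>sqrt n\<close> colours, then that
  average hardly depends on the question in coordinate \<open>i\<close>. So some coordinate \<open>i\<close> is won inside \<open>D\<close>
  with probability at most \<open>val * Pr D + O(n powr (-1/4))\<close>. Splitting \<open>D\<close> according to the questions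
  and answers in coordinate \<open>i\<close> and iterating about \<open>ln n\<close> times gives the polynomial decay.
\<close>

section \<open>Colourings, scaled distributions and decay rates\<close>

text \<open>Vertices are coloured one at a time: a new vertex \<open>v\<close> receives a colour
  whose class carries at most the average weight to and from \<open>v\<close>. Each insertion then
  adds at most the fraction \<open>1 / m\<close> of the new weight.\<close>

lemma greedy_colouring:
  fixes w :: "'v \<Rightarrow> 'v \<Rightarrow> real"
  assumes "finite V" "m > 0"
  shows "\<exists>c. (\<forall>v. c v < m) \<and>
    (\<Sum>i\<in>V. \<Sum>t\<in>V. if i \<noteq> t \<and> c i = c t then w i t else 0)
      \<le> (\<Sum>i\<in>V. \<Sum>t\<in>V. if i \<noteq> t then w i t else 0) / real m"
  using assms(1)
proof (induction V rule: finite_induct)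
  case empty
  then show ?case using assms(2) by (intro exI[of _ "\<lambda>_. 0"]) simp
next
  case (insert v V)
  define x where "x = (\<lambda>i t. if i \<noteq> t then w i t else 0)"
  obtain c where c: "\<And>u. c u < m"
    and IH: "(\<Sum>i\<in>V. \<Sum>t\<in>V. if c i = c t then x i t else 0) \<le> (\<Sum>i\<in>V. \<Sum>t\<in>V. x i t) / real m"
    using insert.IH by (auto simp: x_def if_if_eq_conj conj_commute cong: if_cong)
  \<comment> \<open>\<open>s a\<close> is the monochromatic weight, in both directions, that
    colouring \<open>v\<close> with \<open>a\<close> would create.\<close>
  define s where "s = (\<lambda>a. \<Sum>t\<in>V. if c t = a then x v t + x t v else 0)"
  have "(\<Sum>a<m. s a) = (\<Sum>t\<in>V. \<Sum>a<m. if c t = a then x v t + x t v else 0)"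
    unfolding s_def by (rule sum.swap)
  also have "\<dots> = (\<Sum>t\<in>V. x v t + x t v)"
    using c by (simp add: sum.delta)
  finally have total: "(\<Sum>a<m. s a) = (\<Sum>t\<in>V. x v t + x t v)" .
  have "\<exists>a<m. s a \<le> (\<Sum>t\<in>V. x v t + x t v) / real m"
  proof (rule ccontr)
    assume "\<not> ?thesis"
    then have "(\<Sum>a<m. (\<Sum>t\<in>V. x v t + x t v) / real m) < (\<Sum>a<m. s a)"
      using assms(2) by (intro sum_strict_mono) (auto simp: not_le)
    then show False using total assms(2) by simp
  qed
  then obtain a where a: "a < m" "s a \<le> (\<Sum>t\<in>V. x v t + x t v) / real m" by blast
  define c' where "c' = c(v := a)"
  have c'V: "c' t = c t" if "t \<in> V" for t using that insert.hyps by (auto simp: c'_def)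
  have xvv: "x v v = 0" by (simp add: x_def)
  have "(\<Sum>i\<in>insert v V. \<Sum>t\<in>insert v V. if c' i = c' t then x i t else 0)
      = s a + (\<Sum>i\<in>V. \<Sum>t\<in>V. if c i = c t then x i t else 0)"
    using insert.hyps
    by (simp add: xvv sum.distrib c'V s_def algebra_simps eq_commute[of a] cong: sum.cong if_cong)
      (simp add: c'_def sum.distrib[symmetric] eq_commute[of a] if_distrib add.commute cong: if_cong)
  also have "\<dots> \<le> (\<Sum>t\<in>V. x v t + x t v) / real m + (\<Sum>i\<in>V. \<Sum>t\<in>V. x i t) / real m"
    using a(2) IH by simp
  also have "\<dots> = (\<Sum>i\<in>insert v V. \<Sum>t\<in>insert v V. x i t) / real m"
    using insert.hyps by (simp add: xvv sum.distrib add_divide_distrib)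
  finally have "(\<Sum>i\<in>insert v V. \<Sum>t\<in>insert v V. if i \<noteq> t \<and> c' i = c' t then w i t else 0)
      \<le> (\<Sum>i\<in>insert v V. \<Sum>t\<in>insert v V. if i \<noteq> t then w i t else 0) / real m"
    by (simp add: x_def if_if_eq_conj conj_commute cong: if_cong)
  moreover have "\<forall>u. c' u < m" using c a by (simp add: c'_def)
  ultimately show ?case by blast
qed

lemma prod_of_bool: "finite A \<Longrightarrow> (\<Prod>j\<in>A. of_bool (P j)) = (of_bool (\<forall>j\<in>A. P j) :: real)"
  by (induction A rule: finite_induct) auto

lemma prob_eq_expectation: "measure_pmf.prob p {x. P x} = measure_pmf.expectation p (\<lambda>x. of_bool (P x))"
proof -
  have "(\<lambda>x. of_bool (P x)) = (indicator {x. P x} :: _ \<Rightarrow> real)" by (auto simp: fun_eq_iff indicator_def)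
  then show ?thesis by simp
qed

text \<open>Normalise \<open>h\<close> by its sum. If the sum is zero then \<open>h\<close> vanishes
  on \<open>A\<close> and a point mass will do, so that even a player with no mass left has a legal
  answer distribution.\<close>

lemma ex_scaled_pmf:
  fixes h :: "'a \<Rightarrow> real"
  assumes "finite A" "A \<noteq> {}" "\<And>b. b \<in> A \<Longrightarrow> 0 \<le> h b"
  shows "\<exists>p. set_pmf p \<subseteq> A \<and> (\<forall>b\<in>A. h b = sum h A * pmf p b)"
proof (cases "sum h A = 0")
  case True
  then have "\<forall>b\<in>A. h b = 0" using assms by (simp add: sum_nonneg_eq_0_iff)
  then show ?thesis using True assms(2) by (intro exI[of _ "return_pmf (SOME b. b \<in> A)"]) (auto intro: someI)
next
  case False
  then have pos: "sum h A > 0" using assms by (simp add: order_less_le sum_nonneg)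
  define f where "f = (\<lambda>b. if b \<in> A then h b / sum h A else 0)"
  have f0: "0 \<le> f b" for b using assms pos by (simp add: f_def)
  have "(\<integral>\<^sup>+b. f b \<partial>count_space UNIV) = (\<Sum>b\<in>A. ennreal (f b))"
    using assms(1) by (intro nn_integral_count_space') (auto simp: f_def)
  also have "\<dots> = ennreal (\<Sum>b\<in>A. f b)" using f0 by (simp add: sum_ennreal)
  also have "(\<Sum>b\<in>A. f b) = 1" using pos by (simp add: f_def flip: sum_divide_distrib)
  finally have int: "(\<integral>\<^sup>+b. f b \<partial>count_space UNIV) = 1" by simp
  have "set_pmf (embed_pmf f) \<subseteq> A"
    using f0 int by (auto simp: set_embed_pmf f_def split: if_splits)
  moreover have "h b = sum h A * pmf (embed_pmf f) b" if "b \<in> A" for b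
    using that pos f0 int by (simp add: pmf_embed_pmf) (simp add: f_def)
  ultimately show ?thesis by blast
qed

text \<open>Take \<open>m\<close> about \<open>b * ln n\<close>: for small \<open>b\<close> the
  growth of \<open>B ^ m\<close> uses up only half of the exponent \<open>a\<close>, while
  \<open>v ^ m\<close> is already bounded by a negative power of \<open>n\<close>. The constant
  factor left over is absorbed by halving the exponent for large \<open>n\<close>, and by
  \<open>p n \<le> v\<close> for the finitely many small \<open>n\<close>.\<close>

lemma polynomial_decay:
  fixes p :: "nat \<Rightarrow> real"
  assumes v: "0 \<le> v" "v < 1" and K: "0 \<le> K" and B: "1 \<le> B" and a: "0 < a"
    and pv: "\<And>n. n \<ge> 1 \<Longrightarrow> p n \<le> v"
    and p: "\<And>n m. n \<ge> 1 \<Longrightarrow> p n \<le> v ^ m + B ^ m * (K * real n powr (- a))"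
  shows "\<exists>c>0. \<forall>n\<ge>1. p n \<le> real n powr (- c)"
proof -
  \<comment> \<open>The lower bound \<open>1 / 2\<close> keeps \<open>ln u\<close> meaningful when
    \<open>v\<close> is zero.\<close>
  define u where "u = max v (1 / 2)"
  have u: "0 < u" "u < 1" "v \<le> u" using v by (auto simp: u_def)
  \<comment> \<open>This makes \<open>(B + 1) powr (b * ln n)\<close> equal to
    \<open>n powr (a / 2)\<close>. The base is \<open>B + 1\<close> because \<open>ln B\<close> is
    zero for \<open>B = 1\<close>.\<close>
  define b where "b = a / (2 * ln (B + 1))"
  have lnB: "ln (B + 1) > 0" using B by simp
  have b: "b > 0" using a lnB by (simp add: b_def)
  define c0 where "c0 = min (b * - ln u) (a / 2)"
  have c0: "c0 > 0" using b a u by (simp add: c0_def mult_pos_neg)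
  define L where "L = 1 / u + K"
  have L: "L > 0" using u K by (simp add: L_def add_pos_nonneg)
  have bound: "p n \<le> L * real n powr (- c0)" if n: "n \<ge> 1" for n
  proof -
    define m where "m = nat \<lfloor>b * ln (real n)\<rfloor>"
    have ln0: "ln (real n) \<ge> 0" using n by simp
    have pos: "b * ln (real n) \<ge> 0" using b ln0 by simp
    have m1: "real m \<le> b * ln (real n)" and m2: "b * ln (real n) \<le> real m + 1"
      using pos unfolding m_def by linarith+
    have n0: "real n > 0" using n by simp
    have "v ^ m \<le> u ^ m" using v u by (intro power_mono)
    also have "\<dots> = u powr real m" using u by (simp add: powr_realpow)
    \<comment> \<open>Rounding \<open>m\<close> down loses at most one in the exponent, hence the
      term \<open>1 / u\<close> in \<open>L\<close>.\<close>
    also have "\<dots> \<le> u powr (b * ln (real n) - 1)"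
      using u m2 by (intro powr_mono') auto
    also have "\<dots> = real n powr (b * ln u) / u"
      using u n0 by (simp add: powr_diff) (simp add: powr_def mult_ac)
    also have "\<dots> \<le> real n powr (- c0) / u"
      using u n by (intro divide_right_mono powr_mono) (auto simp: c0_def)
    finally have 1: "v ^ m \<le> 1 / u * real n powr (- c0)" by simp
    have "B ^ m \<le> (B + 1) ^ m" using B by (intro power_mono) auto
    also have "\<dots> = (B + 1) powr real m" using B by (simp add: powr_realpow)
    also have "\<dots> \<le> (B + 1) powr (b * ln (real n))" using B m1 by (intro powr_mono) auto
    also have "\<dots> = real n powr (a / 2)"
      using B n0 lnB by (simp add: powr_def b_def)
    finally have "B ^ m * (K * real n powr (- a)) \<le> real n powr (a / 2) * (K * real n powr (- a))"
      using K by (intro mult_right_mono) auto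
    also have "\<dots> = K * real n powr (a / 2 + - a)" unfolding powr_add by simp
    also have "\<dots> \<le> K * real n powr (- c0)"
      using K n by (intro mult_left_mono powr_mono) (auto simp: c0_def)
    finally have 2: "B ^ m * (K * real n powr (- a)) \<le> K * real n powr (- c0)" .
    show ?thesis using p[OF n, of m] 1 2 by (simp add: L_def algebra_simps)
  qed
  have "eventually (\<lambda>n. L * real n powr (- c0) \<le> real n powr (- (c0 / 2))) sequentially"
    using c0 L by real_asymp
  then obtain N where N: "\<And>n. n \<ge> N \<Longrightarrow> L * real n powr (- c0) \<le> real n powr (- (c0 / 2))"
    by (auto simp: eventually_sequentially)
  \<comment> \<open>For \<open>n < N\<close> the second bound on \<open>c\<close> below gives
    \<open>u \<le> M powr (- c) \<le> n powr (- c)\<close>; \<open>M\<close> is at least 2 to make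
    \<open>ln M\<close> positive.\<close>
  define M where "M = real (max N 2)"
  have M: "M > 1" by (simp add: M_def)
  define c where "c = min (c0 / 2) (- ln u / ln M)"
  have cle: "c \<le> c0 / 2" "c \<le> - ln u / ln M"
    by (simp_all only: c_def min.cobounded1 min.cobounded2)
  have c: "c > 0" using c0 u M by (simp add: c_def divide_neg_pos)
  have "p n \<le> real n powr (- c)" if n: "n \<ge> 1" for n
  proof (cases "n \<ge> N")
    case True
    have "p n \<le> real n powr (- (c0 / 2))" using bound[OF n] N[OF True] by simp
    also have "\<dots> \<le> real n powr (- c)" using n cle(1) by (intro powr_mono) auto
    finally show ?thesis .
  next
    case False
    then have nM: "real n \<le> M" by (simp add: M_def)
    have "p n \<le> u" using pv[OF n] u by simp
    also have "u = M powr (ln u / ln M)" using u M by (simp add: powr_def)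
    also have "\<dots> \<le> M powr (- c)" using M cle(2) by (intro powr_mono) auto
    also have "\<dots> \<le> real n powr (- c)" using n nM c by (intro powr_mono2') auto
    finally show ?thesis .
  qed
  then show ?thesis using c by blast
qed

section \<open>Conditional expectations in one coordinate\<close>

locale finite_support =
  fixes Q :: "'w pmf"
  assumes finite_support: "finite (set_pmf Q)"
begin

lemma sum_pmf_support: "(\<Sum>y\<in>set_pmf Q. pmf Q y) = 1"
  by (simp add: sum_pmf_eq_1 finite_support)

definition mean :: "('w \<Rightarrow> real) \<Rightarrow> real" where
  "mean f = (\<Sum>y\<in>set_pmf Q. pmf Q y * f y)"

text \<open>Off the support the kernel is the distribution itself, so that all its rows sum to \<open>1\<close>.\<close>

definition cond_kernel :: "('w \<Rightarrow> 'c) \<Rightarrow> 'w \<Rightarrow> 'w \<Rightarrow> real" where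
  "cond_kernel p z y = (if z \<in> set_pmf Q
     then if p y = p z then pmf Q y / (\<Sum>w\<in>{w\<in>set_pmf Q. p w = p z}. pmf Q w) else 0
     else pmf Q y)"

definition kernel_mean :: "('w \<Rightarrow> 'w \<Rightarrow> real) \<Rightarrow> ('w \<Rightarrow> real) \<Rightarrow> 'w \<Rightarrow> real" where
  "kernel_mean K f z = (\<Sum>y\<in>set_pmf Q. K z y * f y)"

lemma class_weight_pos:
  assumes "z \<in> set_pmf Q"
  shows "(\<Sum>w\<in>{w\<in>set_pmf Q. p w = p z}. pmf Q w) > 0"
proof (rule sum_pos)
  show "finite {w \<in> set_pmf Q. p w = p z}" by (rule finite_subset[OF _ finite_support]) blast
  show "{w \<in> set_pmf Q. p w = p z} \<noteq> {}" using assms by blast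
  show "0 < pmf Q w" if "w \<in> {w \<in> set_pmf Q. p w = p z}" for w
    using that by (blast intro: pmf_positive)
qed

lemma sum_class: "(\<Sum>y\<in>set_pmf Q. if p y = c then g y else 0) = (\<Sum>y\<in>{y\<in>set_pmf Q. p y = c}. g y)"
  for g :: "'w \<Rightarrow> real"
  by (simp add: sum.inter_filter finite_support)

lemma cond_kernel_row_sum: "(\<Sum>y\<in>set_pmf Q. cond_kernel p z y) = 1"
proof (cases "z \<in> set_pmf Q")
  case True
  then show ?thesis
    using class_weight_pos[OF True, of p]
    by (simp add: cond_kernel_def sum_class flip: sum_divide_distrib)
qed (simp add: cond_kernel_def sum_pmf_support)

lemma cond_kernel_cong:
  "z \<in> set_pmf Q \<Longrightarrow> z' \<in> set_pmf Q \<Longrightarrow> p z = p z' \<Longrightarrow> cond_kernel p z y = cond_kernel p z' y"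
  by (simp add: cond_kernel_def)

lemma cond_kernel_eq_0: "z \<in> set_pmf Q \<Longrightarrow> p y \<noteq> p z \<Longrightarrow> cond_kernel p z y = 0"
  by (simp add: cond_kernel_def)

text \<open>Within a class both sides are \<open>pmf Q z * pmf Q y\<close> divided by the class
  weight, across classes both vanish: the kernel is reversible with respect to
  \<open>Q\<close>.\<close>

lemma cond_kernel_balance:
  "z \<in> set_pmf Q \<Longrightarrow> y \<in> set_pmf Q \<Longrightarrow>
    pmf Q z * cond_kernel p z y = pmf Q y * cond_kernel p y z"
  by (simp add: cond_kernel_def)

text \<open>A constant map has a single class, so plain averaging is conditioning on nothing and
  inherits the results on \<open>cond_kernel\<close>.\<close>

lemma cond_kernel_const: "cond_kernel (\<lambda>_. c) = (\<lambda>_. pmf Q)"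
  by (auto simp: cond_kernel_def fun_eq_iff sum_pmf_support)

text \<open>The tower property, from reversibility and the row sums.\<close>

lemma mean_kernel_mean: "mean (kernel_mean (cond_kernel p) f) = mean f"
proof -
  have "mean (kernel_mean (cond_kernel p) f)
      = (\<Sum>z\<in>set_pmf Q. \<Sum>y\<in>set_pmf Q. pmf Q z * cond_kernel p z y * f y)"
    by (simp add: mean_def kernel_mean_def sum_distrib_left mult.assoc)
  also have "\<dots> = (\<Sum>z\<in>set_pmf Q. \<Sum>y\<in>set_pmf Q. pmf Q y * cond_kernel p y z * f y)"
    by (intro sum.cong refl) (simp add: cond_kernel_balance)
  also have "\<dots> = (\<Sum>y\<in>set_pmf Q. pmf Q y * f y * (\<Sum>z\<in>set_pmf Q. cond_kernel p y z))"
    by (subst sum.swap) (simp add: sum_distrib_left mult_ac)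
  finally show ?thesis by (simp add: cond_kernel_row_sum mean_def)
qed

lemma mean_add: "mean (\<lambda>y. f y + g y) = mean f + mean g"
  by (simp add: mean_def algebra_simps sum.distrib)

lemma mean_diff: "mean (\<lambda>y. f y - g y) = mean f - mean g"
  by (simp add: mean_def algebra_simps sum_subtractf)

lemma mean_cmult: "mean (\<lambda>y. c * f y) = c * mean f"
  by (simp add: mean_def sum_distrib_left mult_ac)

lemma mean_const [simp]: "mean (\<lambda>y. c) = c"
  unfolding mean_def sum_distrib_right[symmetric] sum_pmf_support by simp

lemma mean_cong: "(\<And>y. y \<in> set_pmf Q \<Longrightarrow> f y = g y) \<Longrightarrow> mean f = mean g"
  by (simp add: mean_def)

lemma mean_mono: "(\<And>y. y \<in> set_pmf Q \<Longrightarrow> f y \<le> g y) \<Longrightarrow> mean f \<le> mean g"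
  unfolding mean_def by (intro sum_mono mult_left_mono) auto

text \<open>The kernel row of \<open>z\<close> lives on the class of \<open>z\<close>, where
  \<open>u\<close> is constant.\<close>

lemma kernel_mean_pull_out:
  assumes "z \<in> set_pmf Q" and "\<And>y. y \<in> set_pmf Q \<Longrightarrow> p y = p z \<Longrightarrow> u y = u z"
  shows "kernel_mean (cond_kernel p) (\<lambda>y. u y * f y) z = u z * kernel_mean (cond_kernel p) f z"
  unfolding kernel_mean_def sum_distrib_left
proof (intro sum.cong refl)
  fix y assume "y \<in> set_pmf Q"
  then show "cond_kernel p z y * (u y * f y) = u z * (cond_kernel p z y * f y)"
    using assms(2)[of y] cond_kernel_eq_0[OF assms(1), of p y] by (cases "p y = p z") simp_all
qed

text \<open>Conditional expectation is an orthogonal projection: pulling out the factor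
  \<open>P f\<close> shows that \<open>f\<close> and \<open>P f\<close> have the same inner product
  with \<open>P f\<close>.\<close>

lemma kernel_mean_pythagoras:
  fixes p :: "'w \<Rightarrow> 'c"
  defines "P \<equiv> kernel_mean (cond_kernel p)"
  shows "mean (\<lambda>z. (P f z)\<^sup>2) + mean (\<lambda>z. (f z - P f z)\<^sup>2) = mean (\<lambda>z. (f z)\<^sup>2)"
proof -
  have Pcong: "P f y = P f z" if "y \<in> set_pmf Q" "z \<in> set_pmf Q" "p y = p z" for y z
    unfolding P_def kernel_mean_def using cond_kernel_cong[OF that] by simp
  have "mean (\<lambda>z. P f z * f z) = mean (P (\<lambda>z. P f z * f z))"
    by (simp add: P_def mean_kernel_mean)
  also have "\<dots> = mean (\<lambda>z. P f z * P f z)"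
  proof (intro mean_cong)
    fix z assume "z \<in> set_pmf Q"
    then show "P (\<lambda>z. P f z * f z) z = P f z * P f z"
      unfolding P_def by (intro kernel_mean_pull_out Pcong[unfolded P_def])
  qed
  finally have "mean (\<lambda>z. P f z * f z) = mean (\<lambda>z. (P f z)\<^sup>2)" by (simp add: power2_eq_square)
  moreover have "mean (\<lambda>z. (f z - P f z)\<^sup>2)
      = mean (\<lambda>z. (f z)\<^sup>2) - 2 * mean (\<lambda>z. P f z * f z) + mean (\<lambda>z. (P f z)\<^sup>2)"
    unfolding mean_cmult[symmetric] mean_add[symmetric] mean_diff[symmetric]
    by (intro mean_cong) (simp add: power2_diff)
  ultimately show ?thesis by simp
qed

text \<open>On a class of \<open>p\<close> the function \<open>kernel_mean (cond_kernel p) f\<close> is constant, so \<open>f\<close> and \<open>g\<close> have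
  the same differences there.\<close>

lemma class_variation_le:
  fixes f :: "'w \<Rightarrow> real" and p :: "'w \<Rightarrow> 'c"
  defines "g \<equiv> (\<lambda>z. f z - kernel_mean (cond_kernel p) f z)"
  assumes y: "y \<in> set_pmf Q" and z: "z \<in> set_pmf Q" and yz: "p y = p z"
  shows "\<bar>f y - f z\<bar> \<le> (1 / sqrt (pmf Q y) + 1 / sqrt (pmf Q z)) * sqrt (mean (\<lambda>z. (g z)\<^sup>2))"
proof -
  \<comment> \<open>One summand of the mean square is at most the whole.\<close>
  have single: "\<bar>g w\<bar> \<le> 1 / sqrt (pmf Q w) * sqrt (mean (\<lambda>z. (g z)\<^sup>2))" if w: "w \<in> set_pmf Q" for w
  proof -
    have pos: "pmf Q w > 0" using w by (simp add: pmf_positive)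
    have "pmf Q w * (g w)\<^sup>2 \<le> mean (\<lambda>z. (g z)\<^sup>2)"
      unfolding mean_def using w finite_support by (intro member_le_sum) auto
    then have "(g w)\<^sup>2 \<le> mean (\<lambda>z. (g z)\<^sup>2) / pmf Q w"
      using pos by (simp add: field_simps)
    then have "sqrt ((g w)\<^sup>2) \<le> sqrt (mean (\<lambda>z. (g z)\<^sup>2) / pmf Q w)" by (rule real_sqrt_le_mono)
    then show ?thesis by (simp add: real_sqrt_divide)
  qed
  have "kernel_mean (cond_kernel p) f y = kernel_mean (cond_kernel p) f z"
    unfolding kernel_mean_def using cond_kernel_cong[OF y z yz] by simp
  then have "\<bar>f y - f z\<bar> \<le> \<bar>g y\<bar> + \<bar>g z\<bar>" by (simp add: g_def)
  also have "\<dots> \<le> (1 / sqrt (pmf Q y) + 1 / sqrt (pmf Q z)) * sqrt (mean (\<lambda>z. (g z)\<^sup>2))"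
    using single[OF y] single[OF z] by (simp add: algebra_simps)
  finally show ?thesis .
qed

text \<open>A Poincare inequality with constant \<open>C\<close>. It is restricted to functions that
  factor through \<psi>, since functions of \<open>p\<close> make the right-hand side
  vanish.\<close>

definition spectral_gap :: "('w \<Rightarrow> 'b) \<Rightarrow> ('w \<Rightarrow> 'c) \<Rightarrow> real \<Rightarrow> bool" where
  "spectral_gap \<psi> p C \<longleftrightarrow> (\<forall>f. (\<forall>y z. \<psi> y = \<psi> z \<longrightarrow> f y = f z) \<longrightarrow>
     mean (\<lambda>z. (f z - mean f)\<^sup>2) \<le> C * mean (\<lambda>z. (f z - kernel_mean (cond_kernel p) f z)\<^sup>2))"

end

section \<open>Functions on a product space\<close>

locale finite_product = finite_support Q for Q :: "'w pmf" +
  fixes I :: "'i set"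
  assumes finite_index: "finite I"
begin

definition points :: "('i \<Rightarrow> 'w) set" where
  "points = {xs. \<forall>i\<in>I. xs i \<in> set_pmf Q}"

definition expect :: "(('i \<Rightarrow> 'w) \<Rightarrow> real) \<Rightarrow> real" where
  "expect F = measure_pmf.expectation (Pi_pmf I undefined (\<lambda>_. Q)) F"

definition norm2 :: "(('i \<Rightarrow> 'w) \<Rightarrow> real) \<Rightarrow> real" where
  "norm2 F = expect (\<lambda>xs. (F xs)\<^sup>2)"

text \<open>The kernel is arbitrary so that averaging and conditional expectation in one coordinate
  are instances of the same operator.\<close>

definition apply_at :: "('w \<Rightarrow> 'w \<Rightarrow> real) \<Rightarrow> 'i \<Rightarrow> (('i \<Rightarrow> 'w) \<Rightarrow> real) \<Rightarrow> ('i \<Rightarrow> 'w) \<Rightarrow> real" where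
  "apply_at K t F xs = (\<Sum>y\<in>set_pmf Q. K (xs t) y * F (xs(t := y)))"

lemma apply_at_kernel_mean: "apply_at K t F xs = kernel_mean K (\<lambda>y. F (xs(t := y))) (xs t)"
  by (simp add: apply_at_def kernel_mean_def)

text \<open>The fold is independent of the order because operators at different coordinates
  commute.\<close>

definition apply_on :: "('w \<Rightarrow> 'w \<Rightarrow> real) \<Rightarrow> 'i set \<Rightarrow> (('i \<Rightarrow> 'w) \<Rightarrow> real) \<Rightarrow> ('i \<Rightarrow> 'w) \<Rightarrow> real" where
  "apply_on K J F = Finite_Set.fold (apply_at K) F J"

abbreviation avg :: "'i \<Rightarrow> (('i \<Rightarrow> 'w) \<Rightarrow> real) \<Rightarrow> ('i \<Rightarrow> 'w) \<Rightarrow> real" where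
  "avg \<equiv> apply_at (\<lambda>_. pmf Q)"

abbreviation avg_on :: "'i set \<Rightarrow> (('i \<Rightarrow> 'w) \<Rightarrow> real) \<Rightarrow> ('i \<Rightarrow> 'w) \<Rightarrow> real" where
  "avg_on \<equiv> apply_on (\<lambda>_. pmf Q)"

text \<open>The Laplacian in coordinate \<open>t\<close>; its squared norm is the influence of
  \<open>t\<close> on \<open>F\<close>.\<close>

definition lap :: "'i \<Rightarrow> (('i \<Rightarrow> 'w) \<Rightarrow> real) \<Rightarrow> ('i \<Rightarrow> 'w) \<Rightarrow> real" where
  "lap t F = (\<lambda>xs. F xs - avg t F xs)"

lemma avg_mean: "avg t F xs = mean (\<lambda>y. F (xs(t := y)))"
  by (simp add: apply_at_def mean_def)

section \<open>Expectation on the product space\<close>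

lemma finite_Pi_support: "finite (set_pmf (Pi_pmf J undefined (\<lambda>_. Q)))" if "finite J" for J :: "'i set"
  using that finite_support by (auto simp: set_Pi_pmf intro!: finite_PiE_dflt)

lemma integrable_Pi: "finite J \<Longrightarrow> integrable (measure_pmf (Pi_pmf J undefined (\<lambda>_. Q))) F"
  for F :: "('i \<Rightarrow> 'w) \<Rightarrow> real"
  by (intro integrable_measure_pmf_finite finite_Pi_support)

lemma set_Pi_points: "xs \<in> set_pmf (Pi_pmf I undefined (\<lambda>_. Q)) \<Longrightarrow> xs \<in> points"
  using finite_index by (auto simp: set_Pi_pmf PiE_dflt_def points_def)

lemma expect_mono: "(\<And>xs. xs \<in> points \<Longrightarrow> F xs \<le> G xs) \<Longrightarrow> expect F \<le> expect G"
  unfolding expect_def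
  by (intro integral_mono_AE integrable_Pi finite_index) (auto simp: AE_measure_pmf_iff set_Pi_points)

lemma expect_cong: "(\<And>xs. xs \<in> points \<Longrightarrow> F xs = G xs) \<Longrightarrow> expect F = expect G"
  by (intro antisym expect_mono) auto

lemma expect_add: "expect (\<lambda>xs. F xs + G xs) = expect F + expect G"
  unfolding expect_def by (intro Bochner_Integration.integral_add integrable_Pi finite_index)

lemma expect_diff: "expect (\<lambda>xs. F xs - G xs) = expect F - expect G"
  unfolding expect_def by (intro Bochner_Integration.integral_diff integrable_Pi finite_index)

lemma expect_cmult: "expect (\<lambda>xs. c * F xs) = c * expect F"
  unfolding expect_def by simp

lemma expect_sum: "expect (\<lambda>xs. \<Sum>a\<in>A. F a xs) = (\<Sum>a\<in>A. expect (F a))"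
  unfolding expect_def by (intro Bochner_Integration.integral_sum integrable_Pi finite_index)

lemma expect_const [simp]: "expect (\<lambda>xs. c) = c"
  unfolding expect_def by simp

lemma expect_nonneg: "(\<And>xs. xs \<in> points \<Longrightarrow> 0 \<le> F xs) \<Longrightarrow> 0 \<le> expect F"
  using expect_mono[of "\<lambda>_. 0" F] by simp

lemma norm2_nonneg: "0 \<le> norm2 F"
  unfolding norm2_def by (intro expect_nonneg) simp

lemma expect_abs_le: "\<bar>expect F\<bar> \<le> expect (\<lambda>xs. \<bar>F xs\<bar>)"
  using expect_mono[of F "\<lambda>xs. \<bar>F xs\<bar>", OF abs_ge_self]
    expect_mono[of "\<lambda>xs. - 1 * F xs" "\<lambda>xs. \<bar>F xs\<bar>"]
  unfolding expect_cmult by (simp add: abs_le_iff)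

text \<open>Jensen's inequality, read off from the nonnegative variance of
  \<open>\<bar>F\<bar>\<close>.\<close>

lemma expect_abs_le_norm2: "expect (\<lambda>xs. \<bar>F xs\<bar>) \<le> sqrt (norm2 F)"
proof -
  define m where "m = expect (\<lambda>xs. \<bar>F xs\<bar>)"
  have "0 \<le> expect (\<lambda>xs. (\<bar>F xs\<bar> - m)\<^sup>2)" by (intro expect_nonneg) simp
  also have "\<dots> = expect (\<lambda>xs. (F xs)\<^sup>2 - (2 * m) * \<bar>F xs\<bar> + m\<^sup>2)"
    by (intro expect_cong) (simp add: power2_diff)
  also have "\<dots> = norm2 F - 2 * m * m + m\<^sup>2"
    by (simp only: expect_add expect_diff expect_cmult expect_const norm2_def m_def)
  finally have "m\<^sup>2 \<le> norm2 F" by (simp add: power2_eq_square)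
  then show ?thesis unfolding m_def by (rule real_le_rsqrt)
qed

lemma expect_mult_le:
  assumes "\<And>xs. xs \<in> points \<Longrightarrow> \<bar>U xs\<bar> \<le> 1"
  shows "\<bar>expect (\<lambda>xs. U xs * F xs)\<bar> \<le> sqrt (norm2 F)"
proof -
  have "\<bar>expect (\<lambda>xs. U xs * F xs)\<bar> \<le> expect (\<lambda>xs. \<bar>U xs * F xs\<bar>)" by (rule expect_abs_le)
  also have "\<dots> \<le> expect (\<lambda>xs. \<bar>F xs\<bar>)"
    using assms by (intro expect_mono) (simp add: abs_mult mult_left_le_one_le)
  also have "\<dots> \<le> sqrt (norm2 F)" by (rule expect_abs_le_norm2)
  finally show ?thesis .
qed

text \<open>By independence the expectation of any function is that of its average in coordinate
  \<open>t\<close> over the remaining coordinates. Averaging twice is averaging once, so both sides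
  agree.\<close>

lemma expect_avg:
  assumes "t \<in> I"
  shows "expect (avg t H) = expect H"
proof -
  define R where "R = Pi_pmf (I - {t}) undefined (\<lambda>_. Q)"
  have fin: "finite (I - {t})" using finite_index by simp
  have finR: "finite (set_pmf R)" unfolding R_def by (rule finite_Pi_support[OF fin])
  have eq: "Pi_pmf I undefined (\<lambda>_. Q) = Q \<bind> (\<lambda>y. map_pmf (\<lambda>f. f(t := y)) R)"
    using assms Pi_pmf_insert'[OF fin, of t undefined "\<lambda>_. Q"]
    by (simp add: insert_absorb map_pmf_def R_def)
  have *: "expect H = measure_pmf.expectation R (avg t H)" for H
  proof -
    have "expect H = (\<Sum>y\<in>set_pmf Q. pmf Q y * measure_pmf.expectation R (\<lambda>f. H (f(t := y))))"
      unfolding expect_def eq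
      by (subst pmf_expectation_bind[where A = "set_pmf Q"]) (use finite_support finR in simp_all)
    also have "\<dots> = measure_pmf.expectation R (\<lambda>f. \<Sum>y\<in>set_pmf Q. pmf Q y * H (f(t := y)))"
      by (subst Bochner_Integration.integral_sum) (auto intro!: integrable_measure_pmf_finite finR)
    finally show ?thesis by (simp add: apply_at_def[abs_def])
  qed
  have "avg t (avg t H) = avg t H"
    by (simp add: fun_eq_iff apply_at_def sum_pmf_support flip: sum_distrib_right)
  then show ?thesis by (simp add: *)
qed

lemma avg_apply_at: "avg t (apply_at (cond_kernel p) t H) = avg t H"
  by (simp add: fun_eq_iff avg_mean apply_at_kernel_mean mean_kernel_mean)

lemma apply_at_avg: "apply_at (cond_kernel p) t (avg t H) = avg t H"
  by (simp add: fun_eq_iff apply_at_def cond_kernel_row_sum flip: sum_distrib_right)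

lemma expect_apply_at: "t \<in> I \<Longrightarrow> expect (apply_at (cond_kernel p) t H) = expect H"
  using expect_avg[of t H] expect_avg[of t "apply_at (cond_kernel p) t H"]
  by (simp add: avg_apply_at)

section \<open>Operators acting in several coordinates\<close>

lemma apply_at_commute:
  assumes "s \<noteq> t"
  shows "apply_at K s (apply_at K' t F) = apply_at K' t (apply_at K s F)"
proof
  fix xs
  have "apply_at K s (apply_at K' t F) xs
      = (\<Sum>y\<in>set_pmf Q. \<Sum>z\<in>set_pmf Q. K (xs s) y * (K' (xs t) z * F (xs(s := y, t := z))))"
    using assms by (simp add: apply_at_def sum_distrib_left)
  also have "\<dots> = (\<Sum>z\<in>set_pmf Q. \<Sum>y\<in>set_pmf Q. K (xs s) y * (K' (xs t) z * F (xs(s := y, t := z))))"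
    by (rule sum.swap)
  also have "\<dots> = apply_at K' t (apply_at K s F) xs"
    using assms by (simp add: apply_at_def sum_distrib_left fun_upd_twist[OF assms] mult.left_commute)
  finally show "apply_at K s (apply_at K' t F) xs = apply_at K' t (apply_at K s F) xs" .
qed

lemma comp_fun_commute_apply_at: "comp_fun_commute (apply_at K)"
proof
  fix s t
  show "apply_at K s \<circ> apply_at K t = apply_at K t \<circ> apply_at K s"
    by (cases "s = t") (auto simp: fun_eq_iff apply_at_commute)
qed

lemma apply_on_empty [simp]: "apply_on K {} F = F"
  by (simp add: apply_on_def)

lemma apply_on_insert:
  "finite J \<Longrightarrow> t \<notin> J \<Longrightarrow> apply_on K (insert t J) F = apply_at K t (apply_on K J F)"
  unfolding apply_on_def
  by (rule comp_fun_commute_on.fold_insert[OF comp_fun_commute_apply_at[unfolded comp_fun_commute_def']])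
    auto

lemma apply_at_apply_on_commute:
  "finite J \<Longrightarrow> t \<notin> J \<Longrightarrow> apply_at K t (apply_on K' J F) = apply_on K' J (apply_at K t F)"
proof (induction J rule: finite_induct)
  case (insert s J)
  then show ?case by (simp add: apply_on_insert apply_at_commute[of t s])
qed simp

lemma apply_on_insert':
  "finite J \<Longrightarrow> t \<notin> J \<Longrightarrow> apply_on K (insert t J) F = apply_on K J (apply_at K t F)"
  by (simp add: apply_on_insert apply_at_apply_on_commute)

lemma apply_at_diff: "apply_at K t (\<lambda>xs. F xs - G xs) = (\<lambda>xs. apply_at K t F xs - apply_at K t G xs)"
  by (simp add: apply_at_def fun_eq_iff algebra_simps sum_subtractf)

lemma apply_at_sum: "apply_at K t (\<lambda>xs. \<Sum>a\<in>A. F a xs) = (\<lambda>xs. \<Sum>a\<in>A. apply_at K t (F a) xs)"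
  by (auto simp: apply_at_def fun_eq_iff sum_distrib_left intro: sum.swap)

lemma apply_on_diff:
  "finite J \<Longrightarrow> apply_on K J (\<lambda>xs. F xs - G xs) = (\<lambda>xs. apply_on K J F xs - apply_on K J G xs)"
  by (induction J rule: finite_induct) (simp_all add: apply_on_insert apply_at_diff)

lemma apply_on_sum:
  "finite J \<Longrightarrow> apply_on K J (\<lambda>xs. \<Sum>a\<in>A. F a xs) = (\<lambda>xs. \<Sum>a\<in>A. apply_on K J (F a) xs)"
  by (induction J rule: finite_induct) (simp_all add: apply_on_insert apply_at_sum)

lemma avg_bounds:
  assumes "\<And>xs. 0 \<le> F xs \<and> F xs \<le> 1"
  shows "0 \<le> avg t F xs \<and> avg t F xs \<le> 1"
  using assms mean_mono[of "\<lambda>_. 0" "\<lambda>y. F (xs(t := y))"] mean_mono[of "\<lambda>y. F (xs(t := y))" "\<lambda>_. 1"]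
  by (simp add: avg_mean)

lemma avg_on_bounds:
  assumes "finite J" and "\<And>xs. 0 \<le> F xs \<and> F xs \<le> 1"
  shows "0 \<le> avg_on J F xs \<and> avg_on J F xs \<le> 1"
  using assms(1)
proof (induction J arbitrary: xs rule: finite_induct)
  case (insert t J)
  then show ?case using avg_bounds[of "avg_on J F"] by (simp add: apply_on_insert)
qed (use assms(2) in simp)

section \<open>Orthogonality and influences\<close>

text \<open>The one-coordinate identity holds on every fibre in direction \<open>t\<close>; it
  remains to integrate over the fibres.\<close>

lemma norm2_apply_at_pythagoras:
  assumes "t \<in> I"
  shows "norm2 (apply_at (cond_kernel p) t F) + norm2 (\<lambda>xs. F xs - apply_at (cond_kernel p) t F xs)
    = norm2 F"
proof -
  have "avg t (\<lambda>xs. (apply_at (cond_kernel p) t F xs)\<^sup>2) xs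
      + avg t (\<lambda>xs. (F xs - apply_at (cond_kernel p) t F xs)\<^sup>2) xs = avg t (\<lambda>xs. (F xs)\<^sup>2) xs" for xs
    using kernel_mean_pythagoras[of p "\<lambda>y. F (xs(t := y))"]
    by (simp add: avg_mean apply_at_kernel_mean)
  then have "expect (\<lambda>xs. avg t (\<lambda>xs. (apply_at (cond_kernel p) t F xs)\<^sup>2) xs
      + avg t (\<lambda>xs. (F xs - apply_at (cond_kernel p) t F xs)\<^sup>2) xs) = expect (avg t (\<lambda>xs. (F xs)\<^sup>2))"
    by (simp add: fun_eq_iff[symmetric])
  then show ?thesis
    unfolding expect_add by (simp add: expect_avg[OF assms] norm2_def)
qed

lemma norm2_avg_pythagoras: "t \<in> I \<Longrightarrow> norm2 (avg t F) + norm2 (lap t F) = norm2 F"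
  using norm2_apply_at_pythagoras[of t "\<lambda>_. ()" F] by (simp add: cond_kernel_const lap_def)

lemma norm2_apply_at_le: "t \<in> I \<Longrightarrow> norm2 (apply_at (cond_kernel p) t F) \<le> norm2 F"
  using norm2_apply_at_pythagoras[of t p F] norm2_nonneg by (smt (verit))

lemma norm2_avg_le: "t \<in> I \<Longrightarrow> norm2 (avg t F) \<le> norm2 F"
  using norm2_apply_at_le[of t "\<lambda>_. ()" F] by (simp add: cond_kernel_const)

lemma lap_apply_at_commute: "s \<noteq> t \<Longrightarrow> lap s (apply_at K t F) = apply_at K t (lap s F)"
  by (simp add: lap_def apply_at_diff apply_at_commute[of s t])

text \<open>An Efron-Stein inequality. Adding \<open>s\<close> to \<open>J\<close> splits the
  difference into the orthogonal parts \<open>lap s F\<close> and the average over \<open>s\<close>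
  of the previous difference, and averaging does not increase the norm.\<close>

lemma norm2_diff_avg_on_le:
  assumes "finite J" "J \<subseteq> I"
  shows "norm2 (\<lambda>xs. F xs - avg_on J F xs) \<le> (\<Sum>t\<in>J. norm2 (lap t F))"
  using assms
proof (induction J rule: finite_induct)
  case empty
  then show ?case by (simp add: norm2_def)
next
  case (insert s J)
  define H where "H = (\<lambda>xs. F xs - avg_on (insert s J) F xs)"
  have idem: "avg s (avg s G) = avg s G" for G
    by (simp add: fun_eq_iff apply_at_def sum_pmf_support flip: sum_distrib_right)
  have "avg s H = avg s (\<lambda>xs. F xs - avg_on J F xs)"
    using insert.hyps by (simp add: H_def apply_on_insert apply_at_diff idem)
  moreover from this have "lap s H = lap s F"
    using insert.hyps by (simp add: H_def lap_def apply_on_insert apply_at_diff)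
  ultimately have "norm2 H = norm2 (avg s (\<lambda>xs. F xs - avg_on J F xs)) + norm2 (lap s F)"
    using norm2_avg_pythagoras[of s H] insert.prems by simp
  also have "\<dots> \<le> norm2 (\<lambda>xs. F xs - avg_on J F xs) + norm2 (lap s F)"
    using norm2_avg_le insert.prems by simp
  also have "\<dots> \<le> (\<Sum>t\<in>insert s J. norm2 (lap t F))"
    using insert by simp
  finally show ?case by (simp add: H_def)
qed

text \<open>When \<open>s\<close> joins \<open>J\<close>, its own term is exactly the drop in
  squared norm caused by averaging over \<open>s\<close>, and the earlier terms only shrink under
  this extra average. The drops telescope.\<close>

lemma sum_norm2_lap_avg_on_le:
  assumes "finite J" "J \<subseteq> I"
  shows "(\<Sum>t\<in>J. norm2 (lap t (avg_on (J - {t}) F))) \<le> norm2 F - norm2 (avg_on J F)"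
  using assms
proof (induction J rule: finite_induct)
  case (insert s J)
  have "norm2 (lap t (avg_on (insert s J - {t}) F)) \<le> norm2 (lap t (avg_on (J - {t}) F))"
    if "t \<in> J" for t
  proof -
    have "insert s J - {t} = insert s (J - {t})" using that insert.hyps by auto
    moreover have "s \<noteq> t" using that insert.hyps by auto
    ultimately have "lap t (avg_on (insert s J - {t}) F) = avg s (lap t (avg_on (J - {t}) F))"
      using insert.hyps by (simp add: apply_on_insert lap_apply_at_commute)
    then show ?thesis using norm2_avg_le insert.prems by simp
  qed
  then have "(\<Sum>t\<in>J. norm2 (lap t (avg_on (insert s J - {t}) F)))
      \<le> (\<Sum>t\<in>J. norm2 (lap t (avg_on (J - {t}) F)))"
    by (rule sum_mono)
  moreover have "norm2 (avg_on (insert s J) F) + norm2 (lap s (avg_on J F)) = norm2 (avg_on J F)"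
    using norm2_avg_pythagoras[of s "avg_on J F"] insert by (simp add: apply_on_insert)
  ultimately show ?case using insert by (simp add: insert_absorb)
qed simp

section \<open>Functions factoring through a map in a coordinate\<close>

text \<open>The result type is left open because the notion also serves for events and for answer
  vectors.\<close>

definition depends_at :: "('w \<Rightarrow> 'b) \<Rightarrow> 'i \<Rightarrow> (('i \<Rightarrow> 'w) \<Rightarrow> 'r) \<Rightarrow> bool" where
  "depends_at \<psi> t F \<longleftrightarrow> (\<forall>xs y z. \<psi> y = \<psi> z \<longrightarrow> F (xs(t := y)) = F (xs(t := z)))"

lemma depends_atI:
  "(\<And>xs y z. \<psi> y = \<psi> z \<Longrightarrow> F (xs(t := y)) = F (xs(t := z))) \<Longrightarrow> depends_at \<psi> t F"
  unfolding depends_at_def by (intro allI impI)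

lemma depends_atD: "depends_at \<psi> t F \<Longrightarrow> \<psi> y = \<psi> z \<Longrightarrow> F (xs(t := y)) = F (xs(t := z))"
  unfolding depends_at_def by (drule spec, drule spec, drule spec, erule mp)

lemma depends_at_apply_at:
  assumes st: "s \<noteq> t" and F: "depends_at \<psi> t F"
  shows "depends_at \<psi> t (apply_at K s F)"
proof (rule depends_atI)
  fix xs y z assume yz: "\<psi> y = \<psi> z"
  have "F (xs(t := y, s := w)) = F (xs(t := z, s := w))" for w
    unfolding fun_upd_twist[OF st[symmetric]]
    by (rule depends_atD[OF F yz])
  then show "apply_at K s F (xs(t := y)) = apply_at K s F (xs(t := z))"
    using st by (simp add: apply_at_def)
qed

lemma depends_at_apply_on:
  "finite J \<Longrightarrow> t \<notin> J \<Longrightarrow> depends_at \<psi> t F \<Longrightarrow> depends_at \<psi> t (apply_on K J F)"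
  by (induction J rule: finite_induct) (auto simp: apply_on_insert intro: depends_at_apply_at)

lemma depends_at_avg: "depends_at \<psi> t F \<Longrightarrow> depends_at \<psi> t (avg s F)"
proof (cases "s = t")
  case True
  then show ?thesis by (intro depends_atI) (simp add: apply_at_def)
qed (simp add: depends_at_apply_at)

lemma depends_at_avg_on: "finite J \<Longrightarrow> depends_at \<psi> t F \<Longrightarrow> depends_at \<psi> t (avg_on J F)"
  by (induction J rule: finite_induct) (auto simp: apply_on_insert intro: depends_at_avg)

text \<open>Conditioning keeps the average in direction \<open>t\<close> and can only reduce the
  variance there. The gap bounds the variance of \<open>F\<close> itself by its distance to the
  conditional expectation, and by Pythagoras that distance is the drop in squared norm.\<close>

lemma norm2_lap_apply_at_le:
  assumes t: "t \<in> I" and gap: "spectral_gap \<psi> p C" and F: "depends_at \<psi> t F"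
  shows "norm2 (lap t (apply_at (cond_kernel p) t F))
    \<le> C * (norm2 F - norm2 (apply_at (cond_kernel p) t F))"
proof -
  let ?P = "apply_at (cond_kernel p) t"
  have "norm2 (lap t (?P F)) + norm2 (avg t F) = norm2 (?P F)"
    using norm2_avg_pythagoras[OF t, of "?P F"] by (simp add: avg_apply_at)
  then have "norm2 (lap t (?P F)) \<le> norm2 (lap t F)"
    using norm2_avg_pythagoras[OF t, of F] norm2_apply_at_le[OF t, of p F] by simp
  also have "\<dots> = expect (avg t (\<lambda>xs. (lap t F xs)\<^sup>2))"
    by (simp add: norm2_def expect_avg[OF t])
  also have "\<dots> \<le> expect (\<lambda>xs. C * avg t (\<lambda>xs. (F xs - ?P F xs)\<^sup>2) xs)"
  proof (intro expect_mono)
    fix xs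
    let ?f = "\<lambda>y. F (xs(t := y))"
    have "\<forall>y z. \<psi> y = \<psi> z \<longrightarrow> ?f y = ?f z"
      by (intro allI impI depends_atD[OF F])
    then have "mean (\<lambda>z. (?f z - mean ?f)\<^sup>2) \<le> C * mean (\<lambda>z. (?f z - kernel_mean (cond_kernel p) ?f z)\<^sup>2)"
      by (rule gap[unfolded spectral_gap_def, THEN spec[of _ ?f], THEN mp])
    then show "avg t (\<lambda>xs. (lap t F xs)\<^sup>2) xs \<le> C * avg t (\<lambda>xs. (F xs - ?P F xs)\<^sup>2) xs"
      by (simp add: avg_mean lap_def apply_at_kernel_mean)
  qed
  also have "\<dots> = C * norm2 (\<lambda>xs. F xs - ?P F xs)"
    by (simp add: expect_cmult expect_avg[OF t] norm2_def)
  also have "\<dots> = C * (norm2 F - norm2 (?P F))"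
    by (simp flip: norm2_apply_at_pythagoras[OF t, of p F])
  finally show ?thesis .
qed

text \<open>Each coordinate is charged with the drop in norm at the moment it is conditioned;
  \<open>F\<close> still factors through \<psi> there because only other coordinates were treated
  before. Later steps do not increase its Laplacian, so the drops telescope.\<close>

lemma sum_norm2_lap_apply_on_le:
  assumes "finite J" "J \<subseteq> I" "spectral_gap \<psi> p C" "\<And>t. t \<in> I \<Longrightarrow> depends_at \<psi> t F"
  shows "(\<Sum>t\<in>J. norm2 (lap t (apply_on (cond_kernel p) J F)))
    \<le> C * (norm2 F - norm2 (apply_on (cond_kernel p) J F))"
  using assms(1,2)
proof (induction J rule: finite_induct)
  case (insert s J)
  let ?P = "apply_on (cond_kernel p)"
  have "norm2 (lap t (?P (insert s J) F)) \<le> norm2 (lap t (?P J F))" if "t \<in> J" for t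
  proof -
    have "s \<noteq> t" using that insert.hyps by auto
    then have "lap t (?P (insert s J) F) = apply_at (cond_kernel p) s (lap t (?P J F))"
      using insert.hyps by (simp add: apply_on_insert lap_apply_at_commute)
    then show ?thesis
      using norm2_apply_at_le[of s p "lap t (?P J F)"] insert.prems by simp
  qed
  then have "(\<Sum>t\<in>J. norm2 (lap t (?P (insert s J) F))) \<le> (\<Sum>t\<in>J. norm2 (lap t (?P J F)))"
    by (rule sum_mono)
  moreover have "norm2 (lap s (?P (insert s J) F)) \<le> C * (norm2 (?P J F) - norm2 (?P (insert s J) F))"
    using norm2_lap_apply_at_le[of s \<psi> p C "?P J F"] insert assms
    by (simp add: apply_on_insert depends_at_apply_on)
  ultimately show ?case using insert by (simp add: algebra_simps)
qed simp

section \<open>Influences visible to the other players\<close>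

text \<open>The influence of \<open>t\<close> that remains for an observer who sees only the value
  of \<open>p\<close> in each coordinate.\<close>

definition cond_influence :: "('w \<Rightarrow> 'c) \<Rightarrow> (('i \<Rightarrow> 'w) \<Rightarrow> real) \<Rightarrow> 'i \<Rightarrow> real" where
  "cond_influence p F t = norm2 (lap t (apply_on (cond_kernel p) I F))"

lemma cond_influence_nonneg: "0 \<le> cond_influence p F t"
  by (simp add: cond_influence_def norm2_nonneg)

lemma norm2_le_1: "(\<And>xs. 0 \<le> F xs \<and> F xs \<le> 1) \<Longrightarrow> norm2 F \<le> 1"
  unfolding norm2_def
  using expect_mono[of "\<lambda>xs. (F xs)\<^sup>2" "\<lambda>_. 1"] by (simp add: power_le_one)

text \<open>The squared norm starts at most at 1 and stays nonnegative, so the telescoped drops give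
  a bound that does not grow with \<open>I\<close>.\<close>

lemma sum_cond_influence_le:
  assumes "spectral_gap \<psi> p C" "0 \<le> C" "\<And>t. t \<in> I \<Longrightarrow> depends_at \<psi> t F"
    and "\<And>xs. 0 \<le> F xs \<and> F xs \<le> 1"
  shows "(\<Sum>t\<in>I. cond_influence p F t) \<le> C"
proof -
  have "(\<Sum>t\<in>I. cond_influence p F t) \<le> C * (norm2 F - norm2 (apply_on (cond_kernel p) I F))"
    unfolding cond_influence_def by (rule sum_norm2_lap_apply_on_le[OF finite_index]) (use assms in auto)
  also have "\<dots> \<le> C * 1"
    using assms(2) norm2_le_1[of F, OF assms(4)] norm2_nonneg[of "apply_on (cond_kernel p) I F"]
    by (intro mult_left_mono) auto
  finally show ?thesis by simp
qed

text \<open>In every coordinate \<open>U\<close> is constant on the classes of \<open>p\<close> and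
  can be moved inside the conditional expectation, which leaves the total expectation
  unchanged.\<close>

lemma expect_mult_apply_on:
  assumes "finite J" "J \<subseteq> I" "\<And>t. t \<in> I \<Longrightarrow> depends_at p t U"
  shows "expect (\<lambda>xs. U xs * apply_on (cond_kernel p) J F xs) = expect (\<lambda>xs. U xs * F xs)"
  using assms(1,2)
proof (induction J rule: finite_induct)
  case (insert t J)
  let ?P = "apply_at (cond_kernel p) t"
  have t: "t \<in> I" using insert.prems by simp
  \<comment> \<open>Restricted to \<open>points\<close>, as off the support the kernel does not
    respect the classes of \<open>p\<close>.\<close>
  have pull: "?P (\<lambda>xs. U xs * G xs) xs = U xs * ?P G xs" if "xs \<in> points" for xs G
  proof -
    have "xs t \<in> set_pmf Q" using that t by (simp add: points_def)
    moreover have "U (xs(t := y)) = U (xs(t := xs t))" if "p y = p (xs t)" for y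
      by (rule depends_atD[OF assms(3)[OF t] that])
    ultimately show ?thesis
      using kernel_mean_pull_out[of "xs t" p "\<lambda>y. U (xs(t := y))" "\<lambda>y. G (xs(t := y))"]
      by (simp add: apply_at_kernel_mean)
  qed
  have "expect (\<lambda>xs. U xs * apply_on (cond_kernel p) (insert t J) F xs)
      = expect (?P (\<lambda>xs. U xs * apply_on (cond_kernel p) J F xs))"
    using insert.hyps by (intro expect_cong) (simp add: apply_on_insert pull)
  also have "\<dots> = expect (\<lambda>xs. U xs * apply_on (cond_kernel p) J F xs)"
    by (rule expect_apply_at[OF t])
  finally show ?case using insert by simp
qed simp

text \<open>At \<open>t\<close> itself averaging and conditioning absorb each other in either order;
  at all other coordinates the operators commute.\<close>

lemma avg_apply_on_commute:
  assumes "t \<in> I"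
  shows "avg t (apply_on (cond_kernel p) I F) = apply_on (cond_kernel p) I (avg t F)"
proof -
  have I: "insert t (I - {t}) = I" using assms by auto
  have fin: "finite (I - {t})" using finite_index by simp
  have "avg t (apply_on (cond_kernel p) (insert t (I - {t})) F)
      = apply_on (cond_kernel p) (insert t (I - {t})) (avg t F)"
    using fin by (simp only: apply_on_insert' apply_at_apply_on_commute avg_apply_at apply_at_avg
        Diff_iff insert_iff simp_thms)
  then show ?thesis by (simp only: I)
qed

lemma avg_on_apply_on_commute:
  "finite J \<Longrightarrow> J \<subseteq> I \<Longrightarrow>
    avg_on J (apply_on (cond_kernel p) I F) = apply_on (cond_kernel p) I (avg_on J F)"
  by (induction J rule: finite_induct) (simp_all add: apply_on_insert avg_apply_on_commute)

text \<open>The factor \<open>U\<close> only depends on the classes of \<open>p\<close>, so \<open>F\<close> may first be replaced by its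
  conditional expectation given these classes.\<close>

lemma expect_mult_diff_avg_on_le:
  assumes J: "J \<subseteq> I" and U: "\<And>t. t \<in> I \<Longrightarrow> depends_at p t U"
    and U1: "\<And>xs. \<bar>U xs\<bar> \<le> 1"
  shows "\<bar>expect (\<lambda>xs. U xs * (F xs - avg_on J F xs))\<bar> \<le> sqrt (\<Sum>t\<in>J. cond_influence p F t)"
proof -
  let ?P = "apply_on (cond_kernel p) I"
  have fin: "finite J" using J finite_index by (rule finite_subset)
  have "expect (\<lambda>xs. U xs * (F xs - avg_on J F xs))
      = expect (\<lambda>xs. U xs * ?P (\<lambda>xs. F xs - avg_on J F xs) xs)"
    by (rule expect_mult_apply_on[symmetric, OF finite_index subset_refl U])
  also have "\<dots> = expect (\<lambda>xs. U xs * (?P F xs - avg_on J (?P F) xs))"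
    by (simp add: apply_on_diff finite_index avg_on_apply_on_commute fin J)
  also have "\<bar>\<dots>\<bar> \<le> sqrt (norm2 (\<lambda>xs. ?P F xs - avg_on J (?P F) xs))"
    by (rule expect_mult_le[OF U1])
  also have "\<dots> \<le> sqrt (\<Sum>t\<in>J. cond_influence p F t)"
    unfolding cond_influence_def by (intro real_sqrt_le_mono norm2_diff_avg_on_le fin J)
  finally show ?thesis .
qed

lemma depends_at_mono:
  assumes "depends_at \<psi> t F" and "\<And>y z. p y = p z \<Longrightarrow> \<psi> y = \<psi> z"
  shows "depends_at p t F"
  by (rule depends_atI) (rule depends_atD[OF assms(1) assms(2)])

lemma depends_at_prod:
  assumes "\<And>l. l \<in> A \<Longrightarrow> depends_at p t (F l)"
  shows "depends_at p t (\<lambda>xs. \<Prod>l\<in>A. F l xs)"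
  by (rule depends_atI, rule prod.cong[OF refl], rule depends_atD[OF assms])

lemma depends_at_mult:
  fixes F G :: "('i \<Rightarrow> 'w) \<Rightarrow> real"
  assumes "depends_at p t F" "depends_at p t G"
  shows "depends_at p t (\<lambda>xs. F xs * G xs)"
  by (rule depends_atI, rule arg_cong2[where f = "(*)"])
    (rule depends_atD[OF assms(1)] depends_atD[OF assms(2)], assumption)+

text \<open>A hybrid argument: the factors are replaced one at a time. While factor \<open>m\<close>
  is exchanged, all the others, averaged or not, are functions of what \<open>p m\<close>
  retains.\<close>

lemma expect_prod_avg_on:
  fixes g :: "nat \<Rightarrow> ('i \<Rightarrow> 'w) \<Rightarrow> real" and \<psi> :: "nat \<Rightarrow> 'w \<Rightarrow> 'b" and p :: "nat \<Rightarrow> 'w \<Rightarrow> 'c"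
  assumes J: "J \<subseteq> I"
    and g: "\<And>l t. l < k \<Longrightarrow> t \<in> I \<Longrightarrow> depends_at (\<psi> l) t (g l)"
    and g1: "\<And>l xs. l < k \<Longrightarrow> 0 \<le> g l xs \<and> g l xs \<le> 1"
    and p: "\<And>l j y z. l < k \<Longrightarrow> j < k \<Longrightarrow> l \<noteq> j \<Longrightarrow> p j y = p j z \<Longrightarrow> \<psi> l y = \<psi> l z"
  shows "\<bar>expect (\<lambda>xs. \<Prod>l<k. g l xs) - expect (\<lambda>xs. \<Prod>l<k. avg_on J (g l) xs)\<bar>
    \<le> (\<Sum>l<k. sqrt (\<Sum>t\<in>J. cond_influence (p l) (g l) t))"
proof -
  have fin: "finite J" using J finite_index by (rule finite_subset)
  \<comment> \<open>In the hybrid \<open>h m\<close> the factors below \<open>m\<close> are already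
    averaged.\<close>
  define h where "h = (\<lambda>m xs. (\<Prod>l<m. avg_on J (g l) xs) * (\<Prod>l\<in>{m..<k}. g l xs))"
  have "\<bar>expect (h 0) - expect (h m)\<bar> \<le> (\<Sum>l<m. sqrt (\<Sum>t\<in>J. cond_influence (p l) (g l) t))"
    if "m \<le> k" for m
    using that
  proof (induction m)
    case (Suc m)
    define U where "U = (\<lambda>xs. (\<Prod>l<m. avg_on J (g l) xs) * (\<Prod>l\<in>{Suc m..<k}. g l xs))"
    have m: "m < k" using Suc.prems by simp
    have dep: "depends_at (p m) t U" if "t \<in> I" for t
      unfolding U_def
    proof (rule depends_at_mult; rule depends_at_prod)
      fix l assume "l \<in> {..<m}"
      then have l: "l < k" "l \<noteq> m" using m by auto
      show "depends_at (p m) t (avg_on J (g l))"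
        by (rule depends_at_mono[OF depends_at_avg_on[OF fin g[OF l(1) that]] p[OF l(1) m l(2)]])
    next
      fix l assume "l \<in> {Suc m..<k}"
      then have l: "l < k" "l \<noteq> m" using m by auto
      show "depends_at (p m) t (g l)"
        by (rule depends_at_mono[OF g[OF l(1) that] p[OF l(1) m l(2)]])
    qed
    have U1: "\<bar>U xs\<bar> \<le> 1" for xs
    proof -
      have "0 \<le> (\<Prod>l<m. avg_on J (g l) xs)" "(\<Prod>l<m. avg_on J (g l) xs) \<le> 1"
        using avg_on_bounds[OF fin g1] m by (auto intro!: prod_nonneg prod_le_1)
      moreover have "0 \<le> (\<Prod>l\<in>{Suc m..<k}. g l xs)" "(\<Prod>l\<in>{Suc m..<k}. g l xs) \<le> 1"
        using g1 by (auto intro!: prod_nonneg prod_le_1)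
      ultimately show ?thesis by (simp add: U_def abs_mult mult_le_one)
    qed
    have h: "h m = (\<lambda>xs. U xs * g m xs)" "h (Suc m) = (\<lambda>xs. U xs * avg_on J (g m) xs)"
      using m by (simp_all add: h_def U_def fun_eq_iff prod.atLeast_Suc_lessThan)
    have "expect (h m) - expect (h (Suc m)) = expect (\<lambda>xs. U xs * (g m xs - avg_on J (g m) xs))"
      unfolding h by (simp add: right_diff_distrib expect_diff)
    then have "\<bar>expect (h m) - expect (h (Suc m))\<bar> \<le> sqrt (\<Sum>t\<in>J. cond_influence (p m) (g m) t)"
      using expect_mult_diff_avg_on_le[OF J dep U1] by simp
    then show ?case using Suc by simp
  qed simp
  from this[of k] show ?thesis by (simp add: h_def atLeast0LessThan)
qed

text \<open>The set \<open>J\<close> is the rest of the colour class of \<open>i\<close> in a colouring of the coordinates with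
  \<open>m\<close> colours.\<close>

lemma obtain_block:
  fixes w :: "'i \<Rightarrow> 'i \<Rightarrow> real" and h :: "'r \<Rightarrow> ('i \<Rightarrow> 'w) \<Rightarrow> real"
  assumes m: "m > 0" and I: "I \<noteq> {}"
    and w0: "\<And>i t. 0 \<le> w i t" and w: "\<And>i. i \<in> I \<Longrightarrow> (\<Sum>t\<in>I. w i t) \<le> C"
    and h: "\<And>r xs. r \<in> R \<Longrightarrow> 0 \<le> h r xs \<and> h r xs \<le> 1"
  obtains i J where "i \<in> I" "J \<subseteq> I - {i}"
    "(\<Sum>t\<in>J. w i t) + (\<Sum>r\<in>R. norm2 (lap i (avg_on J (h r))))
      \<le> C / real m + real m * real (card R) / real (card I)"
proof -
  obtain c where c: "\<And>v. c v < m" and mono: "(\<Sum>i\<in>I. \<Sum>t\<in>I. if i \<noteq> t \<and> c i = c t then w i t else 0)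
      \<le> (\<Sum>i\<in>I. \<Sum>t\<in>I. if i \<noteq> t then w i t else 0) / real m"
    using greedy_colouring[OF finite_index m, of w] by blast
  define J where "J = (\<lambda>i. {t \<in> I. c t = c i} - {i})"
  have cI: "real (card I) > 0" using I finite_index by (simp add: card_gt_0_iff)
  have "(\<Sum>i\<in>I. \<Sum>t\<in>J i. w i t) = (\<Sum>i\<in>I. \<Sum>t\<in>I. if i \<noteq> t \<and> c i = c t then w i t else 0)"
  proof (rule sum.cong[OF refl])
    fix i assume "i \<in> I"
    have "J i = {t \<in> I. i \<noteq> t \<and> c i = c t}" by (auto simp: J_def)
    then show "(\<Sum>t\<in>J i. w i t) = (\<Sum>t\<in>I. if i \<noteq> t \<and> c i = c t then w i t else 0)"
      by (simp only: sum.inter_filter[OF finite_index])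
  qed
  also have "\<dots> \<le> (\<Sum>i\<in>I. \<Sum>t\<in>I. if i \<noteq> t then w i t else 0) / real m" by (rule mono)
  also have "\<dots> \<le> (\<Sum>i\<in>I. \<Sum>t\<in>I. w i t) / real m"
    using w0 by (intro divide_right_mono sum_mono) auto
  also have "\<dots> \<le> (\<Sum>i\<in>I. C) / real m"
    using w by (intro divide_right_mono sum_mono) auto
  finally have 1: "(\<Sum>i\<in>I. \<Sum>t\<in>J i. w i t) \<le> real (card I) * C / real m" by simp
  \<comment> \<open>Inside one colour class \<open>A\<close> the set \<open>J i\<close> is
    \<open>A - {i}\<close>, so the telescoping bound gives at most 1 per colour.\<close>
  have one: "(\<Sum>i\<in>I. norm2 (lap i (avg_on (J i) (h r)))) \<le> real m" if r: "r \<in> R" for r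
  proof -
    have "(\<Sum>i\<in>I. norm2 (lap i (avg_on (J i) (h r))))
        = (\<Sum>a<m. \<Sum>i\<in>{i\<in>I. c i = a}. norm2 (lap i (avg_on (J i) (h r))))"
      using c by (intro sum.group[symmetric] finite_index) auto
    also have "\<dots> \<le> (\<Sum>a<m. 1)"
    proof (intro sum_mono)
      fix a
      let ?A = "{i\<in>I. c i = a}"
      have "(\<Sum>i\<in>?A. norm2 (lap i (avg_on (J i) (h r))))
          = (\<Sum>i\<in>?A. norm2 (lap i (avg_on (?A - {i}) (h r))))"
        by (intro sum.cong refl) (simp add: J_def)
      also have "\<dots> \<le> norm2 (h r) - norm2 (avg_on ?A (h r))"
        using finite_index by (intro sum_norm2_lap_avg_on_le) auto
      also have "\<dots> \<le> 1" using norm2_le_1[of "h r", OF h[OF r]] norm2_nonneg[of "avg_on ?A (h r)"] by simp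
      finally show "(\<Sum>i\<in>?A. norm2 (lap i (avg_on (J i) (h r)))) \<le> 1" .
    qed
    finally show ?thesis by simp
  qed
  have "(\<Sum>i\<in>I. \<Sum>r\<in>R. norm2 (lap i (avg_on (J i) (h r))))
      = (\<Sum>r\<in>R. \<Sum>i\<in>I. norm2 (lap i (avg_on (J i) (h r))))" by (rule sum.swap)
  also have "\<dots> \<le> (\<Sum>r\<in>R. real m)" using one by (rule sum_mono)
  finally have 2: "(\<Sum>i\<in>I. \<Sum>r\<in>R. norm2 (lap i (avg_on (J i) (h r)))) \<le> real (card R) * real m" by simp
  define b where "b = C / real m + real m * real (card R) / real (card I)"
  \<comment> \<open>Both kinds of error are bounded on average over \<open>i\<close>, so one
    coordinate is good for both at once.\<close>
  have "\<exists>i\<in>I. (\<Sum>t\<in>J i. w i t) + (\<Sum>r\<in>R. norm2 (lap i (avg_on (J i) (h r)))) \<le> b"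
  proof (rule ccontr)
    assume "\<not> ?thesis"
    then have "(\<Sum>i\<in>I. b) < (\<Sum>i\<in>I. (\<Sum>t\<in>J i. w i t) + (\<Sum>r\<in>R. norm2 (lap i (avg_on (J i) (h r)))))"
      using I finite_index by (intro sum_strict_mono) (auto simp: not_le)
    also have "\<dots> \<le> real (card I) * C / real m + real (card R) * real m"
      using 1 2 by (simp add: sum.distrib)
    also have "\<dots> = (\<Sum>i\<in>I. b)" using cI by (simp add: b_def field_simps)
    finally show False by simp
  qed
  then obtain i where "i \<in> I" "(\<Sum>t\<in>J i. w i t) + (\<Sum>r\<in>R. norm2 (lap i (avg_on (J i) (h r)))) \<le> b"
    by blast
  then show thesis by (intro that[of i "J i"]) (auto simp: b_def J_def)
qed

lemma avg_on_factor:
  assumes "finite J" "i \<notin> J"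
  shows "avg_on J (\<lambda>xs. c (xs i) * F xs) = (\<lambda>xs. c (xs i) * avg_on J F xs)"
  using assms
proof (induction J rule: finite_induct)
  case (insert t J)
  then show ?case by (simp add: apply_on_insert) (simp add: apply_at_def sum_distrib_left mult_ac)
qed simp

lemma expect_abs_lap_le: "norm2 (lap i F) \<le> d \<Longrightarrow> expect (\<lambda>xs. \<bar>lap i F xs\<bar>) \<le> sqrt d"
  using expect_abs_le_norm2[of "lap i F"] real_sqrt_le_mono by (smt (verit))

end

section \<open>Strategies and connectivity\<close>

context finite_game begin

text \<open>Overwriting entry \<open>j\<close> by a fixed value encodes the questions of the other
  players: two tuples have the same image iff they agree away from \<open>j\<close>.\<close>

abbreviation others :: "nat \<Rightarrow> (nat \<Rightarrow> 'q) \<Rightarrow> nat \<Rightarrow> 'q" where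
  "others j z \<equiv> z(j := undefined)"

lemma finite_question_support: "finite (set_pmf (distr_questions G))"
proof (rule finite_subset)
  show "set_pmf (distr_questions G) \<subseteq> Pi\<^sub>E {..<players G} (questions G)"
    using question_support_subset by (simp add: question_support_def)
  show "finite (Pi\<^sub>E {..<players G} (questions G))"
    using finite_questions by (intro finite_PiE) auto
qed

sublocale finite_support "distr_questions G"
  by unfold_locales (rule finite_question_support)

lemma question_in_questions:
  "s \<in> set_pmf (distr_questions G) \<Longrightarrow> j < players G \<Longrightarrow> s j \<in> questions G j"
  using question_support_subset by (fastforce simp: question_support_def)

section \<open>From connectivity to a Poincare inequality\<close>

text \<open>An arc provides two support tuples that differ only at \<open>j\<close>; they lie in one
  class of \<open>others j\<close>, where the variation is controlled. Since \<open>f\<close> only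
  sees entry \<open>j\<close>, it does not matter which tuple represents a question, and the arcs
  can be chained. The constant does not depend on \<open>f\<close>.\<close>

lemma variation_along_path:
  assumes j: "j < players G" and uv: "u \<rightarrow>\<^sup>*\<^bsub>with_proj (mk_symmetric (with_proj (question_graph G j)))\<^esub> v"
    and y: "y \<in> set_pmf (distr_questions G)" "y j = u"
    and z: "z \<in> set_pmf (distr_questions G)" "z j = v"
  shows "\<exists>c\<ge>0. \<forall>f. (\<forall>y z. y j = z j \<longrightarrow> f y = f z) \<longrightarrow> \<bar>f y - f z\<bar>
    \<le> c * sqrt (mean (\<lambda>z. (f z - kernel_mean (cond_kernel (others j)) f z)\<^sup>2))"
  using uv[unfolded reachable_def] y z
proof (induction arbitrary: z rule: rtrancl_on.induct)
  case (rtrancl_on_refl a)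
  then have yz: "y j = z j" by simp
  show ?case
  proof (intro exI[of _ 0] conjI allI impI)
    fix f :: "(nat \<Rightarrow> 'q) \<Rightarrow> real" assume f: "\<forall>y z. y j = z j \<longrightarrow> f y = f z"
    have "f y = f z" using f[THEN spec[of _ y], THEN spec[of _ z]] yz by (rule mp)
    then show "\<bar>f y - f z\<bar> \<le> 0 * sqrt (mean (\<lambda>z. (f z - kernel_mean (cond_kernel (others j)) f z)\<^sup>2))"
      by simp
  qed simp
next
  case (rtrancl_on_into_rtrancl_on a b c)
  define V where "V = (\<lambda>f. sqrt (mean (\<lambda>z. (f z - kernel_mean (cond_kernel (others j)) f z)\<^sup>2)))"
  \<comment> \<open>Reachability refers to the symmetrised graph, so the arc may point either
    way.\<close>
  have "(b, c) \<in> parcs (question_graph G j) \<or> (c, b) \<in> parcs (question_graph G j)"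
    using rtrancl_on_into_rtrancl_on.hyps(2) by (auto simp: arcs_ends_def arc_to_ends_def mk_symmetric_def)
  then obtain x where x: "x(j := b) \<in> set_pmf (distr_questions G)" "x(j := c) \<in> set_pmf (distr_questions G)"
    by (auto simp: question_graph_def question_support_def)
  obtain c1 where c1: "c1 \<ge> 0" "\<And>f. \<forall>y z. y j = z j \<longrightarrow> f y = f z \<Longrightarrow> \<bar>f y - f (x(j := b))\<bar> \<le> c1 * V f"
    using rtrancl_on_into_rtrancl_on.IH[OF rtrancl_on_into_rtrancl_on.prems(1,2) x(1) fun_upd_same]
    unfolding V_def by blast
  define c2 where "c2 = 1 / sqrt (pmf (distr_questions G) (x(j := b)))
    + 1 / sqrt (pmf (distr_questions G) (x(j := c)))"
  have c2: "c2 \<ge> 0" by (simp add: c2_def)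
  have "\<bar>f y - f z\<bar> \<le> (c1 + c2) * V f" if f: "\<forall>y z. y j = z j \<longrightarrow> f y = f z" for f
  proof -
    have "z j = (x(j := c)) j" using rtrancl_on_into_rtrancl_on.prems by simp
    with f[THEN spec[of _ z], THEN spec[of _ "x(j := c)"]] have "f z = f (x(j := c))" by (rule mp)
    moreover have "\<bar>f (x(j := b)) - f (x(j := c))\<bar> \<le> c2 * V f"
      unfolding c2_def V_def by (rule class_variation_le[OF x]) (simp add: fun_eq_iff)
    ultimately show ?thesis using c1(2)[OF f] by (simp add: algebra_simps)
  qed
  then show ?case unfolding V_def by (intro exI[of _ "c1 + c2"] conjI allI impI add_nonneg_nonneg c1(1) c2)
qed

text \<open>The path bounds put all values of \<open>f\<close> on the support within
  \<open>B * sqrt (D f)\<close> of each other, hence also of the mean.\<close>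

lemma ex_spectral_gap_player:
  assumes con: "playerwise_connected G" and j: "j < players G"
  shows "\<exists>C\<ge>0. spectral_gap (\<lambda>z. z j) (others j) C"
proof -
  let ?S = "set_pmf (distr_questions G)"
  define D where "D = (\<lambda>f. mean (\<lambda>z. (f z - kernel_mean (cond_kernel (others j)) f z)\<^sup>2))"
  have D0: "D f \<ge> 0" for f
    using mean_mono[of "\<lambda>_. 0" "\<lambda>z. (f z - kernel_mean (cond_kernel (others j)) f z)\<^sup>2"] by (simp add: D_def)
  have reach: "u \<rightarrow>\<^sup>*\<^bsub>with_proj (mk_symmetric (with_proj (question_graph G j)))\<^esub> v"
    if "u \<in> questions G j" "v \<in> questions G j" for u v
    using con j that unfolding playerwise_connected_def Digraph_Component.connected_def strongly_connected_def
    by (simp add: mk_symmetric_def question_graph_def)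
  define L where "L = (\<lambda>f :: (nat \<Rightarrow> 'q) \<Rightarrow> real. \<forall>y z. y j = z j \<longrightarrow> f y = f z)"
  have "\<exists>c\<ge>0. \<forall>f. L f \<longrightarrow> \<bar>f y - f z\<bar> \<le> c * sqrt (D f)"
    if "y \<in> ?S" "z \<in> ?S" for y z
    unfolding D_def L_def
    by (rule variation_along_path[OF j reach[of "y j" "z j"]]) (use that j question_in_questions in auto)
  then obtain c where c0: "\<And>y z. y \<in> ?S \<Longrightarrow> z \<in> ?S \<Longrightarrow> c y z \<ge> 0"
    and c: "\<And>y z f. y \<in> ?S \<Longrightarrow> z \<in> ?S \<Longrightarrow> L f \<Longrightarrow> \<bar>f y - f z\<bar> \<le> c y z * sqrt (D f)"
    by metis
  \<comment> \<open>A sum of finitely many nonnegative constants dominates each of them.\<close>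
  define B where "B = (\<Sum>y\<in>?S. \<Sum>z\<in>?S. c y z)"
  have cB: "c y z \<le> B" if "y \<in> ?S" "z \<in> ?S" for y z
  proof -
    have "c y z \<le> (\<Sum>z\<in>?S. c y z)" using that c0 finite_question_support by (intro member_le_sum) auto
    also have "\<dots> \<le> B" unfolding B_def
      using that c0 finite_question_support by (intro member_le_sum[where f = "\<lambda>y. \<Sum>z\<in>?S. c y z"] sum_nonneg) auto
    finally show ?thesis .
  qed
  have "mean (\<lambda>z. (f z - mean f)\<^sup>2) \<le> B\<^sup>2 * D f" if f: "L f" for f
  proof -
    have diff: "\<bar>f y - f z\<bar> \<le> B * sqrt (D f)" if "y \<in> ?S" "z \<in> ?S" for y z
      using c[OF that f] mult_right_mono[OF cB[OF that], of "sqrt (D f)"] D0[of f] by simp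
    have "(f z - mean f)\<^sup>2 \<le> B\<^sup>2 * D f" if z: "z \<in> ?S" for z
    proof -
      have "mean f \<le> mean (\<lambda>_. f z + B * sqrt (D f))"
        using diff[OF z] by (intro mean_mono) (smt (verit))
      moreover have "mean (\<lambda>_. f z - B * sqrt (D f)) \<le> mean f"
        using diff[OF z] by (intro mean_mono) (smt (verit))
      ultimately have "\<bar>f z - mean f\<bar> \<le> B * sqrt (D f)" by simp
      then have "(f z - mean f)\<^sup>2 \<le> (B * sqrt (D f))\<^sup>2"
        by (simp flip: abs_le_square_iff)
      then show ?thesis using D0[of f] by (simp add: power_mult_distrib)
    qed
    then show ?thesis using mean_mono[of "\<lambda>z. (f z - mean f)\<^sup>2" "\<lambda>_. B\<^sup>2 * D f"] by simp
  qed
  then show ?thesis unfolding spectral_gap_def D_def L_def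
    by (intro exI[of _ "B\<^sup>2"] conjI zero_le_power2 allI impI)
qed

text \<open>The inequality weakens as the constant grows, so the sum of the players' constants
  serves all of them.\<close>

lemma ex_spectral_gap:
  assumes con: "playerwise_connected G"
  shows "\<exists>C\<ge>0. \<forall>j<players G. spectral_gap (\<lambda>z. z j) (others j) C"
proof -
  obtain C where C: "\<And>j. j < players G \<Longrightarrow> C j \<ge> 0 \<and> spectral_gap (\<lambda>z. z j) (others j) (C j)"
    using ex_spectral_gap_player[OF con] by metis
  have mono: "spectral_gap \<psi> p b" if "spectral_gap \<psi> p a" "a \<le> b"
    for \<psi> :: "_ \<Rightarrow> 'q" and p :: "_ \<Rightarrow> nat \<Rightarrow> 'q" and a b
    unfolding spectral_gap_def
  proof (intro allI impI)
    fix f :: "(nat \<Rightarrow> 'q) \<Rightarrow> real" assume "\<forall>y z. \<psi> y = \<psi> z \<longrightarrow> f y = f z"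
    then have "mean (\<lambda>z. (f z - mean f)\<^sup>2) \<le> a * mean (\<lambda>z. (f z - kernel_mean (cond_kernel p) f z)\<^sup>2)"
      by (rule that(1)[unfolded spectral_gap_def, THEN spec, THEN mp])
    also have "\<dots> \<le> b * mean (\<lambda>z. (f z - kernel_mean (cond_kernel p) f z)\<^sup>2)"
      using that(2) mean_mono[of "\<lambda>_. 0" "\<lambda>z. (f z - kernel_mean (cond_kernel p) f z)\<^sup>2"]
      by (intro mult_right_mono) auto
    finally show "mean (\<lambda>z. (f z - mean f)\<^sup>2) \<le> b * mean (\<lambda>z. (f z - kernel_mean (cond_kernel p) f z)\<^sup>2)" .
  qed
  have "C j \<le> (\<Sum>j<players G. C j)" if "j < players G" for j
    using that C by (intro member_le_sum) auto
  then have "\<forall>j<players G. spectral_gap (\<lambda>z. z j) (others j) (\<Sum>j<players G. C j)"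
    using C mono by blast
  moreover have "(\<Sum>j<players G. C j) \<ge> 0" using C by (intro sum_nonneg) auto
  ultimately show ?thesis by blast
qed

section \<open>Deterministic and randomised strategies\<close>

lemma win_prob_eq_mean:
  "win_prob G f = mean (\<lambda>s. of_bool (wins G s (\<lambda>j\<in>{..<players G}. f j (s j))))"
proof -
  have "win_prob G f
      = measure_pmf.expectation (distr_questions G) (\<lambda>s. of_bool (wins G s (\<lambda>j\<in>{..<players G}. f j (s j))))"
    unfolding win_prob_def by (rule prob_eq_expectation)
  also have "\<dots> = mean (\<lambda>s. of_bool (wins G s (\<lambda>j\<in>{..<players G}. f j (s j))))"
    unfolding mean_def by (subst integral_measure_pmf[OF finite_question_support]) auto
  finally show ?thesis .
qed

lemma finite_strategies: "finite (strategies G)"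
  unfolding strategies_def using finite_questions finite_answers by (intro finite_PiE) auto

lemma win_prob_le_game_value: "f \<in> strategies G \<Longrightarrow> win_prob G f \<le> game_value G"
  unfolding game_value_def using finite_strategies by (intro Max_ge) auto

text \<open>Private randomness can be drawn before the questions arrive. The strategy is then a
  mixture of deterministic ones, none of which beats the value.\<close>

lemma randomised_strategy_le:
  fixes \<pi> :: "nat \<Rightarrow> 'q \<Rightarrow> 'a pmf"
  assumes \<pi>: "\<And>j u. j < players G \<Longrightarrow> u \<in> questions G j \<Longrightarrow> set_pmf (\<pi> j u) \<subseteq> answers G j"
  shows "mean (\<lambda>s. measure_pmf.prob (Pi_pmf {..<players G} undefined (\<lambda>j. \<pi> j (s j))) {a. wins G s a})
    \<le> game_value G"
proof -
  \<comment> \<open>A random table with an independent answer for every player and every possible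
    question.\<close>
  define \<Phi> where "\<Phi> = Pi_pmf {..<players G} undefined (\<lambda>j. Pi_pmf (questions G j) undefined (\<pi> j))"
  have sub: "set_pmf \<Phi> \<subseteq> strategies G"
  proof
    fix \<phi> assume "\<phi> \<in> set_pmf \<Phi>"
    then have \<phi>: "\<phi> \<in> PiE_dflt {..<players G} undefined
        (\<lambda>j. set_pmf (Pi_pmf (questions G j) undefined (\<pi> j)))"
      by (simp add: \<Phi>_def set_Pi_pmf o_def)
    have out: "\<phi> j = undefined" if "\<not> j < players G" for j
      using \<phi> that by (auto simp: PiE_dflt_def)
    have inn: "\<phi> j \<in> set_pmf (Pi_pmf (questions G j) undefined (\<pi> j))" if "j < players G" for j
      using \<phi> that by (auto simp: PiE_dflt_def)
    have "\<phi> j \<in> questions G j \<rightarrow>\<^sub>E answers G j" if j: "j < players G" for j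
      using inn[OF j] \<pi>[OF j] finite_questions[OF j]
      by (fastforce simp: set_Pi_pmf PiE_dflt_def PiE_iff extensional_def)
    then show "\<phi> \<in> strategies G" using out by (auto simp: strategies_def PiE_iff extensional_def)
  qed
  have fin: "finite (set_pmf \<Phi>)" using sub finite_strategies by (rule finite_subset)
  have eq: "measure_pmf.prob (Pi_pmf {..<players G} undefined (\<lambda>j. \<pi> j (s j))) {a. wins G s a}
      = measure_pmf.expectation \<Phi> (\<lambda>\<phi>. of_bool (wins G s (\<lambda>j\<in>{..<players G}. \<phi> j (s j))))"
    if s: "s \<in> set_pmf (distr_questions G)" for s
  proof -
    \<comment> \<open>Each player looks up a single entry of the table, so the answers to a fixed
      \<open>s\<close> keep their law.\<close>
    have "Pi_pmf {..<players G} undefined (\<lambda>j. \<pi> j (s j))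
        = Pi_pmf {..<players G} undefined
            (\<lambda>j. Pi_pmf (questions G j) undefined (\<pi> j) \<bind> (\<lambda>\<phi>. return_pmf (\<phi> (s j))))"
      using question_in_questions[OF s] finite_questions
      by (intro Pi_pmf_cong) (auto simp: Pi_pmf_component simp flip: map_pmf_def)
    also have "\<dots> = map_pmf (\<lambda>\<phi>. \<lambda>j\<in>{..<players G}. \<phi> j (s j)) \<Phi>"
      by (subst Pi_pmf_bind[where d' = undefined]) (simp_all add: \<Phi>_def map_pmf_def restrict_def)
    finally have "measure_pmf.prob (Pi_pmf {..<players G} undefined (\<lambda>j. \<pi> j (s j))) {a. wins G s a}
        = measure_pmf.prob \<Phi> {\<phi>. wins G s (\<lambda>j\<in>{..<players G}. \<phi> j (s j))}"
      by (simp add: vimage_def)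
    then show ?thesis by (simp only: prob_eq_expectation)
  qed
  have "mean (\<lambda>s. measure_pmf.prob (Pi_pmf {..<players G} undefined (\<lambda>j. \<pi> j (s j))) {a. wins G s a})
      = mean (\<lambda>s. measure_pmf.expectation \<Phi> (\<lambda>\<phi>. of_bool (wins G s (\<lambda>j\<in>{..<players G}. \<phi> j (s j)))))"
    by (rule mean_cong) (rule eq)
  also have "\<dots> = measure_pmf.expectation \<Phi> (win_prob G)"
    unfolding win_prob_eq_mean[abs_def] mean_def
    by (subst Bochner_Integration.integral_sum) (auto intro!: integrable_measure_pmf_finite fin)
  also have "\<dots> \<le> measure_pmf.expectation \<Phi> (\<lambda>_. game_value G)"
    using sub win_prob_le_game_value
    by (intro integral_mono_AE integrable_measure_pmf_finite fin) (auto simp: AE_measure_pmf_iff)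
  finally show ?thesis by simp
qed

abbreviation answer_tuples :: "(nat \<Rightarrow> 'a) set" where
  "answer_tuples \<equiv> Pi\<^sub>E {..<players G} (answers G)"

lemma finite_answer_tuples: "finite answer_tuples"
  using finite_answers by (intro finite_PiE) auto

text \<open>The numbers \<open>H j u b\<close> describe a randomised strategy up to the factors \<open>\<Sum>b. H j u b\<close>, which
  nearly do not depend on the question \<open>u\<close>.\<close>

lemma scaled_strategy_le:
  fixes H :: "nat \<Rightarrow> 'q \<Rightarrow> 'a \<Rightarrow> real"
  assumes H0: "\<And>j u b. 0 \<le> H j u b" and H1: "\<And>j u. j < players G \<Longrightarrow> sum (H j u) (answers G j) \<le> 1"
    and M: "\<And>j. j < players G \<Longrightarrow> 0 \<le> M j \<and> M j \<le> 1"
  shows "mean (\<lambda>s. \<Sum>a\<in>answer_tuples. if wins G s a then \<Prod>j<players G. H j (s j) (a j) else 0)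
    \<le> game_value G * (\<Prod>j<players G. M j)
      + (\<Sum>j<players G. mean (\<lambda>s. \<bar>sum (H j (s j)) (answers G j) - M j\<bar>))"
proof -
  let ?k = "players G"
  have "\<forall>j u. \<exists>p. j < ?k \<longrightarrow> set_pmf p \<subseteq> answers G j \<and>
      (\<forall>b\<in>answers G j. H j u b = sum (H j u) (answers G j) * pmf p b)"
    using ex_scaled_pmf finite_answers answers_nonempty H0 by meson
  then obtain \<pi> where \<pi>: "\<And>j u. j < ?k \<Longrightarrow> set_pmf (\<pi> j u) \<subseteq> answers G j"
    and H: "\<And>j u b. j < ?k \<Longrightarrow> b \<in> answers G j \<Longrightarrow> H j u b = sum (H j u) (answers G j) * pmf (\<pi> j u) b"
    by metis
  define T where "T = (\<lambda>j u. sum (H j u) (answers G j))"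
  define W where "W = (\<lambda>s. measure_pmf.prob (Pi_pmf {..<?k} undefined (\<lambda>j. \<pi> j (s j))) {a. wins G s a})"
  have T: "0 \<le> T j u \<and> T j u \<le> 1" if "j < ?k" for j u
    using that H0 H1 by (simp add: T_def sum_nonneg)
  have W: "0 \<le> W s \<and> W s \<le> 1" for s by (simp add: W_def)
  \<comment> \<open>With \<open>H\<close> written as mass times distribution, the masses leave the
    sum and the winning probability of the randomised strategy remains.\<close>
  have eq: "(\<Sum>a\<in>answer_tuples. if wins G s a then \<Prod>j<?k. H j (s j) (a j) else 0)
      = (\<Prod>j<?k. T j (s j)) * W s" for s
  proof -
    have "W s = (\<Sum>a\<in>answer_tuples. pmf (Pi_pmf {..<?k} undefined (\<lambda>j. \<pi> j (s j))) a
        * of_bool (wins G s a))"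
      unfolding W_def prob_eq_expectation
      using \<pi> by (subst integral_measure_pmf[OF finite_answer_tuples])
        (fastforce simp: set_Pi_pmf PiE_dflt_def PiE_iff extensional_def)+
    also have "\<dots> = (\<Sum>a\<in>answer_tuples. if wins G s a then \<Prod>j<?k. pmf (\<pi> j (s j)) (a j) else 0)"
      by (intro sum.cong refl) (auto simp: pmf_Pi PiE_iff extensional_def)
    finally have "(\<Prod>j<?k. T j (s j)) * W s = (\<Sum>a\<in>answer_tuples.
        if wins G s a then \<Prod>j<?k. T j (s j) * pmf (\<pi> j (s j)) (a j) else 0)"
      by (simp add: sum_distrib_left prod.distrib if_distrib cong: if_cong)
    also have "\<dots> = (\<Sum>a\<in>answer_tuples. if wins G s a then \<Prod>j<?k. H j (s j) (a j) else 0)"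
      by (intro sum.cong refl if_cong prod.cong) (auto simp: T_def PiE_iff intro!: H[symmetric])
    finally show ?thesis by simp
  qed
  have M0: "0 \<le> (\<Prod>j<?k. M j)" using M by (intro prod_nonneg) auto
  have "mean (\<lambda>s. \<Sum>a\<in>answer_tuples. if wins G s a then \<Prod>j<?k. H j (s j) (a j) else 0)
      = mean (\<lambda>s. (\<Prod>j<?k. T j (s j)) * W s)" by (simp add: eq)
  also have "\<dots> \<le> mean (\<lambda>s. (\<Prod>j<?k. M j) * W s + (\<Sum>j<?k. \<bar>T j (s j) - M j\<bar>))"
  proof (rule mean_mono)
    fix s
    have "\<bar>(\<Prod>j<?k. T j (s j)) - (\<Prod>j<?k. M j)\<bar> \<le> (\<Sum>j<?k. \<bar>T j (s j) - M j\<bar>)"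
      using norm_prod_diff[of "{..<?k}" "\<lambda>j. T j (s j)" M] T M by simp
    then have "((\<Prod>j<?k. T j (s j)) - (\<Prod>j<?k. M j)) * W s \<le> (\<Sum>j<?k. \<bar>T j (s j) - M j\<bar>) * 1"
      using W[of s] by (intro mult_mono) (auto intro: sum_nonneg)
    then show "(\<Prod>j<?k. T j (s j)) * W s \<le> (\<Prod>j<?k. M j) * W s + (\<Sum>j<?k. \<bar>T j (s j) - M j\<bar>)"
      by (simp add: left_diff_distrib)
  qed
  also have "\<dots> = (\<Prod>j<?k. M j) * mean W + (\<Sum>j<?k. mean (\<lambda>s. \<bar>T j (s j) - M j\<bar>))"
    unfolding mean_add mean_cmult
    by (simp add: mean_def sum_distrib_left sum.swap[of _ "{..<?k}"])
  also have "(\<Prod>j<?k. M j) * mean W \<le> (\<Prod>j<?k. M j) * game_value G"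
    unfolding W_def using M0 \<pi> by (intro mult_left_mono randomised_strategy_le) auto
  finally show ?thesis by (simp add: T_def mult.commute)
qed

lemma game_value_bounds: "0 \<le> game_value G \<and> game_value G \<le> 1"
proof -
  have "strategies G \<noteq> {}"
    using answers_nonempty by (auto simp: strategies_def PiE_eq_empty_iff)
  then have "game_value G \<in> win_prob G ` strategies G"
    unfolding game_value_def using finite_strategies by (intro Max_in) auto
  then obtain f where "game_value G = win_prob G f" by blast
  then show ?thesis by (simp add: win_prob_def)
qed

end

section \<open>The repeated game\<close>

locale repeated_finite_game = finite_game G for G :: "('q, 'a) game" +
  fixes n :: nat
  assumes n_pos: "n > 0"

sublocale repeated_finite_game \<subseteq> finite_product "distr_questions G" "{..<n}"
  by unfold_locales simp

context repeated_finite_game begin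

text \<open>For predicates this describes a product event, with one event per player.\<close>

definition playerwise :: "(nat \<Rightarrow> (nat \<Rightarrow> nat \<Rightarrow> 'q) \<Rightarrow> 'r) \<Rightarrow> bool" where
  "playerwise F \<longleftrightarrow> (\<forall>j<players G. \<forall>t. depends_at (\<lambda>z. z j) t (F j))"

lemma playerwiseD: "playerwise F \<Longrightarrow> j < players G \<Longrightarrow> depends_at (\<lambda>z. z j) t (F j)"
  by (simp add: playerwise_def)

lemma playerwiseI: "(\<And>j t. j < players G \<Longrightarrow> depends_at (\<lambda>z. z j) t (F j)) \<Longrightarrow> playerwise F"
  by (simp add: playerwise_def)

definition winning :: "(nat \<Rightarrow> (nat \<Rightarrow> nat \<Rightarrow> 'q) \<Rightarrow> nat \<Rightarrow> 'a) \<Rightarrow> nat \<Rightarrow> (nat \<Rightarrow> nat \<Rightarrow> 'q) \<Rightarrow> bool" where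
  "winning ans i xs \<longleftrightarrow> wins G (xs i) (\<lambda>j\<in>{..<players G}. ans j xs i)"

text \<open>Legal answers are demanded at every \<open>xs\<close>, so that splitting by the answer
  is exhaustive everywhere.\<close>

definition answering :: "(nat \<Rightarrow> (nat \<Rightarrow> nat \<Rightarrow> 'q) \<Rightarrow> nat \<Rightarrow> 'a) \<Rightarrow> bool" where
  "answering ans \<longleftrightarrow> playerwise ans \<and> (\<forall>j<players G. \<forall>xs i. ans j xs i \<in> answers G j)"

lemma tuple_eq_iff:
  assumes "i < n" "xs \<in> points" "s \<in> set_pmf (distr_questions G)"
  shows "(\<forall>j<players G. xs i j = s j) \<longleftrightarrow> s = xs i"
proof -
  have "xs i \<in> Pi\<^sub>E {..<players G} (questions G)" "s \<in> Pi\<^sub>E {..<players G} (questions G)"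
    using assms question_support_subset by (auto simp: points_def question_support_def)
  then have "s = xs i" if "\<forall>j<players G. xs i j = s j"
    using that by (intro PiE_ext[of s "{..<players G}" "questions G" "xs i"]) simp_all
  then show ?thesis by blast
qed

lemma answer_eq_iff:
  assumes "answering ans" "a \<in> answer_tuples"
  shows "(\<forall>j<players G. ans j xs i = a j) \<longleftrightarrow> a = (\<lambda>j\<in>{..<players G}. ans j xs i)"
  using assms by (auto simp: PiE_iff extensional_def fun_eq_iff)

text \<open>At each point exactly one pair of question and answer tuples matches coordinate
  \<open>i\<close>. If \<open>E\<close> is a product event and the answers are playerwise, so is
  each piece.\<close>

lemma expect_split:
  assumes ans: "answering ans" and i: "i < n"
  shows "expect (\<lambda>xs. of_bool (E xs \<and> W (xs i) (\<lambda>j\<in>{..<players G}. ans j xs i)) * F xs)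
    = (\<Sum>s\<in>set_pmf (distr_questions G). \<Sum>a\<in>answer_tuples. if W s a
        then expect (\<lambda>xs. of_bool (E xs \<and> (\<forall>j<players G. xs i j = s j \<and> ans j xs i = a j)) * F xs) else 0)"
proof -
  let ?S = "set_pmf (distr_questions G)"
  have "expect (\<lambda>xs. of_bool (E xs \<and> W (xs i) (\<lambda>j\<in>{..<players G}. ans j xs i)) * F xs)
    = expect (\<lambda>xs. \<Sum>s\<in>?S. \<Sum>a\<in>answer_tuples. if W s a
        then of_bool (E xs \<and> (\<forall>j<players G. xs i j = s j \<and> ans j xs i = a j)) * F xs else 0)"
  proof (intro expect_cong)
    fix xs assume xs: "xs \<in> points"
    define a0 where "a0 = (\<lambda>j\<in>{..<players G}. ans j xs i)"
    have a0: "a0 \<in> answer_tuples" using ans by (auto simp: a0_def answering_def)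
    have s0: "xs i \<in> ?S" using xs i by (simp add: points_def)
    have "(\<Sum>s\<in>?S. \<Sum>a\<in>answer_tuples. if W s a
        then of_bool (E xs \<and> (\<forall>j<players G. xs i j = s j \<and> ans j xs i = a j)) * F xs else 0)
      = (\<Sum>s\<in>?S. \<Sum>a\<in>answer_tuples. if s = xs i then if a = a0 then of_bool (E xs \<and> W (xs i) a0) * F xs else 0 else 0)"
    proof (intro sum.cong refl)
      fix s a assume s: "s \<in> ?S" and a: "a \<in> answer_tuples"
      have "(\<forall>j<players G. xs i j = s j \<and> ans j xs i = a j) \<longleftrightarrow> s = xs i \<and> a = a0"
        using tuple_eq_iff[OF i xs s] answer_eq_iff[OF ans a] unfolding a0_def by blast
      then show "(if W s a then of_bool (E xs \<and> (\<forall>j<players G. xs i j = s j \<and> ans j xs i = a j)) * F xs else 0)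
        = (if s = xs i then if a = a0 then of_bool (E xs \<and> W (xs i) a0) * F xs else 0 else 0)"
        by auto
    qed
    also have "\<dots> = (\<Sum>s\<in>?S. if s = xs i then of_bool (E xs \<and> W (xs i) a0) * F xs else 0)"
      using a0 finite_answer_tuples by (intro sum.cong refl) auto
    also have "\<dots> = of_bool (E xs \<and> W (xs i) a0) * F xs"
      using s0 finite_question_support by auto
    finally show "of_bool (E xs \<and> W (xs i) (\<lambda>j\<in>{..<players G}. ans j xs i)) * F xs
      = (\<Sum>s\<in>?S. \<Sum>a\<in>answer_tuples. if W s a
        then of_bool (E xs \<and> (\<forall>j<players G. xs i j = s j \<and> ans j xs i = a j)) * F xs else 0)"
      by (simp add: a0_def)
  qed
  also have "\<dots> = (\<Sum>s\<in>?S. \<Sum>a\<in>answer_tuples. if W s a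
        then expect (\<lambda>xs. of_bool (E xs \<and> (\<forall>j<players G. xs i j = s j \<and> ans j xs i = a j)) * F xs) else 0)"
    by (simp add: expect_sum if_distrib[of expect] cong: if_cong) (intro sum.cong refl, simp)
  finally show ?thesis .
qed

section \<open>A losing coordinate inside a product event\<close>

text \<open>With \<open>r\<close> the square root in the bound, the errors are \<open>k * r\<close>
  for each of the \<open>B\<close> pieces when their factors are averaged, \<open>k * r\<close> for
  masses that vary with the question at \<open>i\<close>, and \<open>2 * k * r\<close> for returning
  from the averaged event to \<open>D\<close>.\<close>

lemma ex_lossy_coordinate_colours:
  assumes gap: "\<And>j. j < players G \<Longrightarrow> spectral_gap (\<lambda>z. z j) (others j) C" and C: "0 \<le> C"
    and D: "playerwise D" and ans: "answering ans" and m: "m > 0"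
  defines "k \<equiv> players G"
    and "B \<equiv> card (set_pmf (distr_questions G)) * card answer_tuples"
  shows "\<exists>i<n. expect (\<lambda>xs. of_bool ((\<forall>j<k. D j xs) \<and> winning ans i xs))
    \<le> game_value G * expect (\<lambda>xs. of_bool (\<forall>j<k. D j xs))
      + (real k * real B + 3 * real k) * sqrt ((real B + 1) * (real k * C) / real m + real m * real k / real n)"
proof -
  let ?S = "set_pmf (distr_questions G)"
  \<comment> \<open>\<open>d\<close> measures the event of a player, \<open>h\<close> splits it by
    the answer at \<open>i\<close> and \<open>g\<close> also by the question, so that products of
    \<open>g\<close> over the players are the pieces of \<open>expect_split\<close>.\<close>
  define d where "d = (\<lambda>j xs. of_bool (D j xs) :: real)"
  define h where "h = (\<lambda>i b j xs. of_bool (D j xs \<and> ans j xs i = b) :: real)"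
  define g where "g = (\<lambda>i s a j xs. of_bool (xs i j = s j) * h i (a j) j xs)"
  \<comment> \<open>The influences of \<open>t\<close> on every function to be averaged once
    \<open>i\<close> is chosen; a single bound then covers all of them.\<close>
  define w where "w = (\<lambda>i t. (\<Sum>j<k. cond_influence (others j) (d j) t)
    + (\<Sum>s\<in>?S. \<Sum>a\<in>answer_tuples. \<Sum>j<k. cond_influence (others j) (g i s a j) t))"
  define \<delta> where "\<delta> = (real B + 1) * (real k * C) / real m + real m * real k / real n"
  have dep_d: "depends_at (\<lambda>z. z j) t (d j)" if "j < k" for j t
    unfolding d_def using that
    by (intro depends_atI arg_cong[of _ _ of_bool] depends_atD[OF playerwiseD[OF D]]) (auto simp: k_def)
  have dep_ans: "depends_at (\<lambda>z. z j) t (ans j)" if "j < k" for j t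
    using that ans by (simp add: answering_def playerwise_def k_def)
  have dep_D: "depends_at (\<lambda>z. z j) t (D j)" if "j < k" for j t
    using that D by (simp add: playerwise_def k_def)
  have dep_h: "depends_at (\<lambda>z. z j) t (h i b j)" if "j < k" for i b j t
    unfolding h_def
  proof (rule depends_atI)
    fix xs :: "nat \<Rightarrow> nat \<Rightarrow> 'q" and y z :: "nat \<Rightarrow> 'q" assume yz: "y j = z j"
    have "D j (xs(t := y)) = D j (xs(t := z))"
      by (rule depends_atD[OF dep_D[OF that]]) (rule yz)
    moreover have "ans j (xs(t := y)) = ans j (xs(t := z))"
      by (rule depends_atD[OF dep_ans[OF that]]) (rule yz)
    ultimately show "of_bool (D j (xs(t := y)) \<and> ans j (xs(t := y)) i = b)
      = (of_bool (D j (xs(t := z)) \<and> ans j (xs(t := z)) i = b) :: real)"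
      by simp
  qed
  have dep_g: "depends_at (\<lambda>z. z j) t (g i s a j)" if "j < k" for i s a j t
    unfolding g_def
  proof (rule depends_at_mult[OF _ dep_h[OF that]])
    show "depends_at (\<lambda>z. z j) t (\<lambda>xs. of_bool (xs i j = s j) :: real)"
      by (rule depends_atI) simp
  qed
  have d1: "0 \<le> d j xs \<and> d j xs \<le> 1" for j xs by (simp add: d_def)
  have g1: "0 \<le> g i s a j xs \<and> g i s a j xs \<le> 1" for i s a j xs by (simp add: g_def h_def)
  have inf_d: "(\<Sum>t<n. cond_influence (others j) (d j) t) \<le> C" if "j < k" for j
    using gap[of j] that dep_d d1 C
    by (intro sum_cond_influence_le[where \<psi> = "\<lambda>z. z j"]) (auto simp: k_def)
  have inf_g: "(\<Sum>t<n. cond_influence (others j) (g i s a j) t) \<le> C" if "j < k" for i s a j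
    using gap[of j] that dep_g g1 C
    by (intro sum_cond_influence_le[where \<psi> = "\<lambda>z. z j"]) (auto simp: k_def)
  have w0: "0 \<le> w i t" for i t
    unfolding w_def by (intro add_nonneg_nonneg sum_nonneg cond_influence_nonneg)
  have wC: "(\<Sum>t<n. w i t) \<le> (real B + 1) * (real k * C)" for i
  proof -
    have "(\<Sum>t<n. w i t) = (\<Sum>j<k. \<Sum>t<n. cond_influence (others j) (d j) t)
        + (\<Sum>s\<in>?S. \<Sum>a\<in>answer_tuples. \<Sum>j<k. \<Sum>t<n. cond_influence (others j) (g i s a j) t)"
      unfolding w_def sum.distrib by (simp add: sum.swap[of _ _ "{..<n}"])
    also have "\<dots> \<le> (\<Sum>j<k. C) + (\<Sum>s\<in>?S. \<Sum>a\<in>answer_tuples. \<Sum>j<k. C)"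
      using inf_d inf_g by (intro add_mono sum_mono) auto
    also have "\<dots> = (real B + 1) * (real k * C)" by (simp add: B_def algebra_simps)
    finally show ?thesis .
  qed
  obtain i J where i: "i < n" and J: "J \<subseteq> {..<n} - {i}"
    and small: "(\<Sum>t\<in>J. w i t) + (\<Sum>j<k. norm2 (lap i (avg_on J (d j)))) \<le> \<delta>"
    using obtain_block[of m w "(real B + 1) * (real k * C)" "{..<k}" d] m n_pos w0 wC d1
    by (auto simp: \<delta>_def lessThan_empty_iff)
  have finJ: "finite J" using J finite_index by (meson finite_Diff finite_subset)
  have JI: "J \<subseteq> {..<n}" and iJ: "i \<notin> J" using J by auto
  define r where "r = sqrt \<delta>"
  have lap0: "0 \<le> (\<Sum>j<k. norm2 (lap i (avg_on J (d j))))" by (intro sum_nonneg norm2_nonneg)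
  have wJ0: "0 \<le> (\<Sum>t\<in>J. w i t)" by (intro sum_nonneg w0)
  have lap_small: "expect (\<lambda>xs. \<bar>lap i (avg_on J (d j)) xs\<bar>) \<le> r" if j: "j < k" for j
    unfolding r_def
  proof (rule expect_abs_lap_le)
    have "norm2 (lap i (avg_on J (d j))) \<le> (\<Sum>j<k. norm2 (lap i (avg_on J (d j))))"
      using j by (intro member_le_sum norm2_nonneg) auto
    then show "norm2 (lap i (avg_on J (d j))) \<le> \<delta>" using small wJ0 by linarith
  qed
  have infJ_d: "sqrt (\<Sum>t\<in>J. cond_influence (others j) (d j) t) \<le> r" if j: "j < k" for j
    unfolding r_def
  proof (rule real_sqrt_le_mono)
    have "cond_influence (others j) (d j) t \<le> w i t" for t
    proof -
      have "cond_influence (others j) (d j) t \<le> (\<Sum>j<k. cond_influence (others j) (d j) t)"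
        using j by (intro member_le_sum cond_influence_nonneg) auto
      also have "\<dots> \<le> w i t" unfolding w_def by (simp add: sum_nonneg cond_influence_nonneg)
      finally show ?thesis .
    qed
    then have "(\<Sum>t\<in>J. cond_influence (others j) (d j) t) \<le> (\<Sum>t\<in>J. w i t)" by (rule sum_mono)
    then show "(\<Sum>t\<in>J. cond_influence (others j) (d j) t) \<le> \<delta>" using small lap0 by linarith
  qed
  have infJ_g: "sqrt (\<Sum>t\<in>J. cond_influence (others j) (g i s a j) t) \<le> r"
    if s: "s \<in> ?S" and a: "a \<in> answer_tuples" and j: "j < k" for s a j
    unfolding r_def
  proof (rule real_sqrt_le_mono)
    have "cond_influence (others j) (g i s a j) t \<le> w i t" for t
    proof -
      have "cond_influence (others j) (g i s a j) t \<le> (\<Sum>j<k. cond_influence (others j) (g i s a j) t)"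
        using j by (intro member_le_sum cond_influence_nonneg) auto
      also have "\<dots> \<le> (\<Sum>a\<in>answer_tuples. \<Sum>j<k. cond_influence (others j) (g i s a j) t)"
        using a finite_answer_tuples
        by (intro member_le_sum[where f = "\<lambda>a. \<Sum>j<k. cond_influence (others j) (g i s a j) t"]
            sum_nonneg cond_influence_nonneg)
      also have "\<dots> \<le> (\<Sum>s\<in>?S. \<Sum>a\<in>answer_tuples. \<Sum>j<k. cond_influence (others j) (g i s a j) t)"
        using s finite_question_support
        by (intro member_le_sum[where f = "\<lambda>s. \<Sum>a\<in>answer_tuples. \<Sum>j<k. cond_influence (others j) (g i s a j) t"]
            sum_nonneg cond_influence_nonneg)
      also have "\<dots> \<le> w i t" unfolding w_def by (simp add: sum_nonneg cond_influence_nonneg)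
      finally show ?thesis .
    qed
    then have "(\<Sum>t\<in>J. cond_influence (others j) (g i s a j) t) \<le> (\<Sum>t\<in>J. w i t)" by (rule sum_mono)
    then show "(\<Sum>t\<in>J. cond_influence (others j) (g i s a j) t) \<le> \<delta>" using small lap0 by linarith
  qed
  have sep: "y l = z l" if "l \<noteq> j" "others j y = others j z" for l j and y z :: "nat \<Rightarrow> 'q"
    using that(1) fun_cong[OF that(2), of l] by simp
  have moll_d: "\<bar>expect (\<lambda>xs. \<Prod>j<k. d j xs) - expect (\<lambda>xs. \<Prod>j<k. avg_on J (d j) xs)\<bar> \<le> real k * r"
  proof -
    have "\<bar>expect (\<lambda>xs. \<Prod>j<k. d j xs) - expect (\<lambda>xs. \<Prod>j<k. avg_on J (d j) xs)\<bar>
        \<le> (\<Sum>j<k. sqrt (\<Sum>t\<in>J. cond_influence (others j) (d j) t))"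
      by (rule expect_prod_avg_on[where \<psi> = "\<lambda>j z. z j" and p = "\<lambda>j z. others j z" and g = d])
        (rule JI, erule dep_d, rule d1, erule (1) sep)
    also have "\<dots> \<le> (\<Sum>j<k. r)" by (intro sum_mono infJ_d) simp
    finally show ?thesis by simp
  qed
  have moll_g: "expect (\<lambda>xs. \<Prod>j<k. g i s a j xs) \<le> expect (\<lambda>xs. \<Prod>j<k. avg_on J (g i s a j) xs) + real k * r"
    if s: "s \<in> ?S" and a: "a \<in> answer_tuples" for s a
  proof -
    have "\<bar>expect (\<lambda>xs. \<Prod>j<k. g i s a j xs) - expect (\<lambda>xs. \<Prod>j<k. avg_on J (g i s a j) xs)\<bar>
        \<le> (\<Sum>j<k. sqrt (\<Sum>t\<in>J. cond_influence (others j) (g i s a j) t))"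
      by (rule expect_prod_avg_on[where \<psi> = "\<lambda>j z. z j" and p = "\<lambda>j z. others j z" and g = "g i s a"])
        (rule JI, erule dep_g, rule g1, erule (1) sep)
    also have "\<dots> \<le> (\<Sum>j<k. r)" by (intro sum_mono infJ_g[OF s a]) simp
    finally show ?thesis by simp
  qed
  have prod_d: "(\<Prod>j<k. d j xs) = of_bool (\<forall>j<k. D j xs)" for xs
    unfolding d_def by (subst prod_of_bool) auto
  have prod_g: "(\<Prod>j<k. g i s a j xs)
      = of_bool ((\<forall>j<k. D j xs) \<and> (\<forall>j<k. xs i j = s j \<and> ans j xs i = a j)) * 1" for s a xs
    unfolding g_def h_def of_bool_conj[symmetric] by (subst prod_of_bool) auto
  have r0: "0 \<le> r" using small lap0 wJ0 by (simp add: r_def)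

  \<comment> \<open>The unnormalised chance of winning on the question tuple \<open>s\<close>, to be
    used at \<open>s = xs i\<close>.\<close>
  define \<Psi> where "\<Psi> = (\<lambda>s xs. \<Sum>a\<in>answer_tuples. if wins G s a then \<Prod>j<k. avg_on J (h i (a j) j) xs else 0)"
  \<comment> \<open>As \<open>i\<close> is outside \<open>J\<close>, the indicator of the question
    at \<open>i\<close> survives the averaging.\<close>
  have Tg: "avg_on J (g i s a j) = (\<lambda>xs. of_bool (xs i j = s j) * avg_on J (h i (a j) j) xs)" for s a j
    unfolding g_def by (rule avg_on_factor[OF finJ iJ, of "\<lambda>z. of_bool (z j = s j)"])

  have "expect (\<lambda>xs. of_bool ((\<forall>j<k. D j xs) \<and> winning ans i xs))
      = (\<Sum>s\<in>?S. \<Sum>a\<in>answer_tuples. if wins G s a then expect (\<lambda>xs. \<Prod>j<k. g i s a j xs) else 0)"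
    using expect_split[OF ans i, of "\<lambda>xs. \<forall>j<k. D j xs" "wins G" "\<lambda>_. 1"]
    unfolding prod_g unfolding winning_def k_def by simp
  also have "\<dots> \<le> (\<Sum>s\<in>?S. \<Sum>a\<in>answer_tuples.
      (if wins G s a then expect (\<lambda>xs. \<Prod>j<k. avg_on J (g i s a j) xs) else 0) + real k * r)"
    using moll_g r0 by (intro sum_mono) auto
  also have "\<dots> = (\<Sum>s\<in>?S. \<Sum>a\<in>answer_tuples.
      if wins G s a then expect (\<lambda>xs. \<Prod>j<k. avg_on J (g i s a j) xs) else 0) + real B * (real k * r)"
    by (simp add: sum.distrib B_def)
  also have "(\<Sum>s\<in>?S. \<Sum>a\<in>answer_tuples.
      if wins G s a then expect (\<lambda>xs. \<Prod>j<k. avg_on J (g i s a j) xs) else 0) = expect (\<lambda>xs. \<Psi> (xs i) xs)"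
  proof -
    have "(\<Sum>s\<in>?S. \<Sum>a\<in>answer_tuples.
        if wins G s a then expect (\<lambda>xs. \<Prod>j<k. avg_on J (g i s a j) xs) else 0)
      = expect (\<lambda>xs. \<Sum>s\<in>?S. \<Sum>a\<in>answer_tuples. if wins G s a then \<Prod>j<k. avg_on J (g i s a j) xs else 0)"
      unfolding expect_sum by (intro sum.cong refl) simp
    also have "\<dots> = expect (\<lambda>xs. \<Psi> (xs i) xs)"
    proof (intro expect_cong)
      fix xs assume xs: "xs \<in> points"
      have "(\<Sum>s\<in>?S. \<Sum>a\<in>answer_tuples. if wins G s a then \<Prod>j<k. avg_on J (g i s a j) xs else 0)
        = (\<Sum>s\<in>?S. if s = xs i then \<Psi> s xs else 0)"
      proof (intro sum.cong refl)
        fix s assume s: "s \<in> ?S"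
        have eq: "(\<Prod>j<k. of_bool (xs i j = s j)) = (of_bool (s = xs i) :: real)"
          using tuple_eq_iff[OF i xs s] by (subst prod_of_bool) (auto simp: k_def)
        show "(\<Sum>a\<in>answer_tuples. if wins G s a then \<Prod>j<k. avg_on J (g i s a j) xs else 0)
          = (if s = xs i then \<Psi> s xs else 0)"
          unfolding Tg prod.distrib eq \<Psi>_def by (simp cong: if_cong)
      qed
      also have "\<dots> = \<Psi> (xs i) xs"
        using xs i finite_question_support by (simp add: points_def)
      finally show "(\<Sum>s\<in>?S. \<Sum>a\<in>answer_tuples. if wins G s a then \<Prod>j<k. avg_on J (g i s a j) xs else 0)
        = \<Psi> (xs i) xs" .
    qed
    finally show ?thesis .
  qed
  \<comment> \<open>With all other coordinates fixed, averaging over the question at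
    \<open>i\<close> leaves one play of \<open>G\<close> with a scaled randomised strategy.\<close>
  also have "expect (\<lambda>xs. \<Psi> (xs i) xs) \<le> game_value G * expect (\<lambda>xs. \<Prod>j<k. avg i (avg_on J (d j)) xs) + real k * r"
  proof -
    have iI: "i \<in> {..<n}" using i by simp
    have step: "avg i (\<lambda>xs. \<Psi> (xs i) xs) xs
        \<le> game_value G * (\<Prod>j<k. avg i (avg_on J (d j)) xs)
          + (\<Sum>j<k. avg i (\<lambda>xs. \<bar>lap i (avg_on J (d j)) xs\<bar>) xs)" for xs
    proof -
      \<comment> \<open>Player \<open>j\<close> only sees entry \<open>j\<close> of the tuple at
        \<open>i\<close>, so a constant tuple can stand in for any tuple with that entry.\<close>
      define H where "H = (\<lambda>j u b. avg_on J (h i b j) (xs(i := (\<lambda>_. u))))"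
      have Th: "avg_on J (h i b j) (xs(i := s)) = H j (s j) b" if "j < k" for j b s
        unfolding H_def by (rule depends_atD[OF depends_at_avg_on[OF finJ dep_h[OF that]]]) simp
      \<comment> \<open>The events of the different answers partition the event of the player, so
        the total mass is the averaged indicator; its deviation from the mean is a Laplacian at
        \<open>i\<close>.\<close>
      have Td: "sum (H j (s j)) (answers G j) = avg_on J (d j) (xs(i := s))" if j: "j < k" for j s
      proof -
        have "d j = (\<lambda>xs. \<Sum>b\<in>answers G j. h i b j xs)"
        proof
          fix xs
          have "(\<Sum>b\<in>answers G j. h i b j xs) = (\<Sum>b\<in>answers G j. if b = ans j xs i then d j xs else 0)"
            by (intro sum.cong refl) (auto simp: h_def d_def)
          also have "\<dots> = d j xs"
            using j ans finite_answers[of j] by (simp add: answering_def k_def)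
          finally show "d j xs = (\<Sum>b\<in>answers G j. h i b j xs)" by simp
        qed
        then have "avg_on J (d j) (xs(i := s)) = (\<Sum>b\<in>answers G j. avg_on J (h i b j) (xs(i := s)))"
          using apply_on_sum[OF finJ] by metis
        then show ?thesis by (simp add: Th[OF j])
      qed
      have "avg i (\<lambda>xs. \<Psi> (xs i) xs) xs
        = mean (\<lambda>s. \<Sum>a\<in>answer_tuples. if wins G s a then \<Prod>j<players G. H j (s j) (a j) else 0)"
        unfolding avg_mean \<Psi>_def k_def
        by (intro mean_cong sum.cong refl if_cong prod.cong) (simp_all add: Th k_def)
      also have "\<dots> \<le> game_value G * (\<Prod>j<players G. avg i (avg_on J (d j)) xs)
          + (\<Sum>j<players G. mean (\<lambda>s. \<bar>sum (H j (s j)) (answers G j) - avg i (avg_on J (d j)) xs\<bar>))"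
      proof (rule scaled_strategy_le)
        show "0 \<le> H j u b" for j u b
          unfolding H_def using avg_on_bounds[OF finJ, of "h i b j"] by (simp add: h_def)
        show "sum (H j u) (answers G j) \<le> 1" if "j < players G" for j u
          using Td[of j "\<lambda>_. u"] that avg_on_bounds[OF finJ d1] by (simp add: k_def)
        show "0 \<le> avg i (avg_on J (d j)) xs \<and> avg i (avg_on J (d j)) xs \<le> 1" for j
          by (rule avg_bounds[OF avg_on_bounds[OF finJ d1]])
      qed
      also have "(\<Sum>j<players G. mean (\<lambda>s. \<bar>sum (H j (s j)) (answers G j) - avg i (avg_on J (d j)) xs\<bar>))
          = (\<Sum>j<k. avg i (\<lambda>xs. \<bar>lap i (avg_on J (d j)) xs\<bar>) xs)"
        unfolding k_def[symmetric] by (intro sum.cong refl) (simp add: Td lap_def avg_mean)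
      finally show ?thesis by (simp add: k_def)
    qed
    have "expect (\<lambda>xs. \<Psi> (xs i) xs) = expect (avg i (\<lambda>xs. \<Psi> (xs i) xs))"
      by (rule expect_avg[OF iI, symmetric])
    also have "\<dots> \<le> expect (\<lambda>xs. game_value G * (\<Prod>j<k. avg i (avg_on J (d j)) xs)
          + (\<Sum>j<k. avg i (\<lambda>xs. \<bar>lap i (avg_on J (d j)) xs\<bar>) xs))"
      by (intro expect_mono step)
    also have "\<dots> = game_value G * expect (\<lambda>xs. \<Prod>j<k. avg i (avg_on J (d j)) xs)
        + (\<Sum>j<k. expect (\<lambda>xs. \<bar>lap i (avg_on J (d j)) xs\<bar>))"
      by (simp add: expect_add expect_cmult expect_sum expect_avg[OF iI])
    also have "\<dots> \<le> game_value G * expect (\<lambda>xs. \<Prod>j<k. avg i (avg_on J (d j)) xs) + (\<Sum>j<k. r)"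
      using lap_small by (intro add_left_mono sum_mono) auto
    finally show ?thesis by simp
  qed
  \<comment> \<open>Undoing the average at \<open>i\<close> costs Laplacians, undoing the one over
    \<open>J\<close> costs influences, at most \<open>k * r\<close> each.\<close>
  also have "game_value G * expect (\<lambda>xs. \<Prod>j<k. avg i (avg_on J (d j)) xs)
      \<le> game_value G * (expect (\<lambda>xs. of_bool (\<forall>j<k. D j xs)) + 2 * (real k * r))"
  proof (rule mult_left_mono)
    have "expect (\<lambda>xs. \<Prod>j<k. avg i (avg_on J (d j)) xs)
        \<le> expect (\<lambda>xs. (\<Prod>j<k. avg_on J (d j) xs) + (\<Sum>j<k. \<bar>lap i (avg_on J (d j)) xs\<bar>))"
    proof (rule expect_mono)
      fix xs
      have "\<bar>(\<Prod>j<k. avg_on J (d j) xs) - (\<Prod>j<k. avg i (avg_on J (d j)) xs)\<bar>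
          \<le> (\<Sum>j<k. \<bar>avg_on J (d j) xs - avg i (avg_on J (d j)) xs\<bar>)"
        using norm_prod_diff[of "{..<k}" "\<lambda>j. avg_on J (d j) xs" "\<lambda>j. avg i (avg_on J (d j)) xs"]
          avg_on_bounds[OF finJ d1] avg_bounds[OF avg_on_bounds[OF finJ d1]] by simp
      then show "(\<Prod>j<k. avg i (avg_on J (d j)) xs)
          \<le> (\<Prod>j<k. avg_on J (d j) xs) + (\<Sum>j<k. \<bar>lap i (avg_on J (d j)) xs\<bar>)"
        by (simp add: lap_def)
    qed
    also have "\<dots> = expect (\<lambda>xs. \<Prod>j<k. avg_on J (d j) xs) + (\<Sum>j<k. expect (\<lambda>xs. \<bar>lap i (avg_on J (d j)) xs\<bar>))"
      by (simp add: expect_add expect_sum)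
    also have "\<dots> \<le> expect (\<lambda>xs. \<Prod>j<k. avg_on J (d j) xs) + (\<Sum>j<k. r)"
      using lap_small by (intro add_left_mono sum_mono) auto
    finally show "expect (\<lambda>xs. \<Prod>j<k. avg i (avg_on J (d j)) xs)
        \<le> expect (\<lambda>xs. of_bool (\<forall>j<k. D j xs)) + 2 * (real k * r)"
      using moll_d unfolding prod_d by simp
  qed (use game_value_bounds in simp)
  also have "game_value G * (expect (\<lambda>xs. of_bool (\<forall>j<k. D j xs)) + 2 * (real k * r))
      \<le> game_value G * expect (\<lambda>xs. of_bool (\<forall>j<k. D j xs)) + 2 * (real k * r)"
    using game_value_bounds r0 by (simp add: distrib_left mult_left_le_one_le)
  finally have "expect (\<lambda>xs. of_bool ((\<forall>j<k. D j xs) \<and> winning ans i xs))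
      \<le> game_value G * expect (\<lambda>xs. of_bool (\<forall>j<k. D j xs)) + (real k * real B + 3 * real k) * r"
    using game_value_bounds by (simp add: algebra_simps)
  then show ?thesis using i unfolding r_def \<delta>_def by blast
qed

lemma answering_cong:
  assumes ans: "answering ans" and j: "j < players G" and yz: "y j = z j"
  shows "ans j (xs(t := y)) = ans j (xs(t := z))"
proof -
  have "playerwise ans" using ans by (simp add: answering_def)
  from playerwiseD[OF this j, of t] show ?thesis by (rule depends_atD) (rule yz)
qed

text \<open>Taking \<open>m\<close> as the floor of \<open>sqrt n\<close> balances the terms of
  order \<open>1 / m\<close> and \<open>m / n\<close>; the outer root gives the exponent
  \<open>- 1 / 4\<close>. The floor costs at most a factor 2.\<close>

lemma ex_lossy_coordinate:
  assumes gap: "\<And>j. j < players G \<Longrightarrow> spectral_gap (\<lambda>z. z j) (others j) C" and C: "0 \<le> C"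
    and D: "playerwise D" and ans: "answering ans"
  defines "k \<equiv> real (players G)"
    and "B \<equiv> real (card (set_pmf (distr_questions G)) * card answer_tuples)"
  shows "\<exists>i<n. expect (\<lambda>xs. of_bool ((\<forall>j<players G. D j xs) \<and> winning ans i xs))
    \<le> game_value G * expect (\<lambda>xs. of_bool (\<forall>j<players G. D j xs))
      + (k * B + 3 * k) * sqrt (2 * (B + 1) * (k * C) + k) * real n powr (- 1 / 4)"
proof -
  define m where "m = nat \<lfloor>sqrt (real n)\<rfloor>"
  have sq1: "sqrt (real n) \<ge> 1" using n_pos by simp
  then have "\<lfloor>sqrt (real n)\<rfloor> \<ge> 1" by (simp add: le_floor_iff)
  then have m: "m > 0" and mle: "real m \<le> sqrt (real n)" and mge: "sqrt (real n) \<le> 2 * real m"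
    unfolding m_def by linarith+
  have kC: "0 \<le> (B + 1) * (k * C)" using C by (simp add: B_def k_def)
  have "(B + 1) * (k * C) / real m \<le> (B + 1) * (k * C) * (2 / sqrt (real n))"
  proof -
    have "2 / (2 * real m) \<le> 2 / sqrt (real n)" using m mge n_pos
      by (intro divide_left_mono mult_pos_pos) auto
    then have "1 / real m \<le> 2 / sqrt (real n)" by simp
    from mult_left_mono[OF this kC] show ?thesis by simp
  qed
  moreover have "real m * k / real n \<le> k / sqrt (real n)"
  proof -
    have "real m * k / real n \<le> sqrt (real n) * k / real n"
      using mle by (intro divide_right_mono mult_right_mono) (auto simp: k_def)
    also have "\<dots> = k / sqrt (real n)" using n_pos by (simp add: field_simps)
    finally show ?thesis .
  qed
  ultimately have "(B + 1) * (k * C) / real m + real m * k / real n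
      \<le> (2 * (B + 1) * (k * C) + k) / sqrt (real n)"
    by (simp add: add_divide_distrib algebra_simps)
  then have "sqrt ((B + 1) * (k * C) / real m + real m * k / real n)
      \<le> sqrt (2 * (B + 1) * (k * C) + k) / sqrt (sqrt (real n))"
    by (metis real_sqrt_le_mono real_sqrt_divide)
  also have "\<dots> = sqrt (2 * (B + 1) * (k * C) + k) * real n powr (- 1 / 4)"
  proof -
    have "sqrt (sqrt (real n)) = real n powr (1 / 4)"
      using n_pos by (simp add: powr_half_sqrt[symmetric] powr_powr)
    then show ?thesis by (simp add: powr_minus_divide)
  qed
  finally have s: "sqrt ((B + 1) * (k * C) / real m + real m * k / real n)
      \<le> sqrt (2 * (B + 1) * (k * C) + k) * real n powr (- 1 / 4)" .
  have nn: "0 \<le> k * B + 3 * k" by (simp add: k_def B_def)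
  obtain i where "i < n" and i: "expect (\<lambda>xs. of_bool ((\<forall>j<players G. D j xs) \<and> winning ans i xs))
    \<le> game_value G * expect (\<lambda>xs. of_bool (\<forall>j<players G. D j xs))
      + (k * B + 3 * k) * sqrt ((B + 1) * (k * C) / real m + real m * k / real n)"
    using ex_lossy_coordinate_colours[OF gap C D ans m] unfolding k_def B_def by auto
  moreover have "(k * B + 3 * k) * sqrt ((B + 1) * (k * C) / real m + real m * k / real n)
      \<le> (k * B + 3 * k) * sqrt (2 * (B + 1) * (k * C) + k) * real n powr (- 1 / 4)"
    using mult_left_mono[OF s nn] by (simp add: mult.assoc)
  ultimately show ?thesis by (intro exI[of _ i]) auto
qed

section \<open>Iteration over product events\<close>

definition all_winning :: "(nat \<Rightarrow> (nat \<Rightarrow> nat \<Rightarrow> 'q) \<Rightarrow> nat \<Rightarrow> 'a) \<Rightarrow> (nat \<Rightarrow> nat \<Rightarrow> 'q) \<Rightarrow> bool" where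
  "all_winning ans xs \<longleftrightarrow> (\<forall>i<n. winning ans i xs)"

text \<open>Winning everywhere includes winning at the coordinate supplied by \<open>step\<close>,
  and this win splits \<open>D\<close> into at most \<open>B - 1\<close> product events to which the
  induction hypothesis applies. The main terms add up to the probability of that win, which yields a
  further factor \<open>v\<close>.\<close>

lemma all_winning_le:
  assumes step: "\<And>D. playerwise D \<Longrightarrow> \<exists>i<n. expect (\<lambda>xs. of_bool ((\<forall>j<players G. D j xs) \<and> winning ans i xs))
    \<le> v * expect (\<lambda>xs. of_bool (\<forall>j<players G. D j xs)) + e"
    and ans: "answering ans" and e: "e \<ge> 0" and v: "0 \<le> v" "v \<le> 1"
    and B: "B = 1 + real (card (set_pmf (distr_questions G)) * card answer_tuples)"
    and D: "playerwise D"
  shows "expect (\<lambda>xs. of_bool ((\<forall>j<players G. D j xs) \<and> all_winning ans xs))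
    \<le> v ^ m * expect (\<lambda>xs. of_bool (\<forall>j<players G. D j xs)) + B ^ m * e"
  using D
proof (induction m arbitrary: D)
  case 0
  have "expect (\<lambda>xs. of_bool ((\<forall>j<players G. D j xs) \<and> all_winning ans xs))
      \<le> expect (\<lambda>xs. of_bool (\<forall>j<players G. D j xs))"
    by (intro expect_mono) simp
  then show ?case using e by simp
next
  case (Suc m)
  let ?S = "set_pmf (distr_questions G)"
  define E where "E = (\<lambda>xs. \<forall>j<players G. D j xs)"
  obtain i where i: "i < n" and lossy: "expect (\<lambda>xs. of_bool (E xs \<and> winning ans i xs))
      \<le> v * expect (\<lambda>xs. of_bool (E xs)) + e"
    using step[OF Suc.prems] unfolding E_def by blast
  \<comment> \<open>Each player can check the refined condition alone, so the piece is again a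
    product event.\<close>
  define D' where "D' = (\<lambda>s a j xs. D j xs \<and> xs i j = s j \<and> ans j xs i = a j)"
  have D': "playerwise (D' s a)" for s a
    unfolding D'_def
  proof (intro playerwiseI depends_atI)
    fix j t xs and y z :: "nat \<Rightarrow> 'q"
    assume j: "j < players G" and yz: "y j = z j"
    have "D j (xs(t := y)) = D j (xs(t := z))"
      by (rule depends_atD[OF playerwiseD[OF Suc.prems j]]) (rule yz)
    moreover have "ans j (xs(t := y)) = ans j (xs(t := z))"
      by (rule answering_cong[OF ans j]) (rule yz)
    ultimately show "(D j (xs(t := y)) \<and> (xs(t := y)) i j = s j \<and> ans j (xs(t := y)) i = a j)
        = (D j (xs(t := z)) \<and> (xs(t := z)) i j = s j \<and> ans j (xs(t := z)) i = a j)"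
      using yz by simp
  qed
  have D'_iff: "(\<forall>j<players G. D' s a j xs) \<longleftrightarrow> E xs \<and> (\<forall>j<players G. xs i j = s j \<and> ans j xs i = a j)" for s a xs
    by (auto simp: D'_def E_def)
  define F where "F = (\<lambda>s a xs. of_bool (E xs \<and> (\<forall>j<players G. xs i j = s j \<and> ans j xs i = a j)) :: real)"
  have "expect (\<lambda>xs. of_bool (E xs \<and> all_winning ans xs))
      = expect (\<lambda>xs. of_bool (E xs \<and> winning ans i xs) * of_bool (all_winning ans xs))"
    using i by (intro expect_cong) (auto simp: all_winning_def)
  also have "\<dots> = (\<Sum>s\<in>?S. \<Sum>a\<in>answer_tuples. if wins G s a
      then expect (\<lambda>xs. F s a xs * of_bool (all_winning ans xs)) else 0)"
    unfolding winning_def F_def by (rule expect_split[OF ans i])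
  also have "\<dots> \<le> (\<Sum>s\<in>?S. \<Sum>a\<in>answer_tuples. (if wins G s a then v ^ m * expect (F s a) else 0) + B ^ m * e)"
  proof (intro sum_mono)
    fix s a
    have "expect (\<lambda>xs. F s a xs * of_bool (all_winning ans xs)) \<le> v ^ m * expect (F s a) + B ^ m * e"
      using Suc.IH[OF D', of s a] unfolding D'_iff F_def of_bool_conj[symmetric] .
    moreover have "0 \<le> B ^ m * e" using e by (simp add: B)
    ultimately show "(if wins G s a then expect (\<lambda>xs. F s a xs * of_bool (all_winning ans xs)) else 0)
        \<le> (if wins G s a then v ^ m * expect (F s a) else 0) + B ^ m * e" by simp
  qed
  also have "\<dots> = v ^ m * (\<Sum>s\<in>?S. \<Sum>a\<in>answer_tuples. if wins G s a then expect (F s a) else 0)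
      + (B - 1) * (B ^ m * e)"
  proof -
    have "(\<Sum>s\<in>?S. \<Sum>a\<in>answer_tuples. x) = (B - 1) * x" for x by (simp add: B)
    moreover have "v ^ m * (if c then x else 0) = (if c then v ^ m * x else 0)" for c x by simp
    ultimately show ?thesis by (simp only: sum.distrib sum_distrib_left)
  qed
  also have "(\<Sum>s\<in>?S. \<Sum>a\<in>answer_tuples. if wins G s a then expect (F s a) else 0)
      = expect (\<lambda>xs. of_bool (E xs \<and> winning ans i xs))"
    using expect_split[OF ans i, of E "wins G" "\<lambda>_. 1"]
    by (simp only: winning_def F_def mult_1_right)
  also have "v ^ m * expect (\<lambda>xs. of_bool (E xs \<and> winning ans i xs))
      \<le> v ^ m * (v * expect (\<lambda>xs. of_bool (E xs)) + e)"
    using v lossy by (intro mult_left_mono) auto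
  \<comment> \<open>The error of this round takes one share of \<open>B ^ m * e\<close>; with the
    \<open>B - 1\<close> shares from the pieces this makes \<open>B ^ Suc m * e\<close>.\<close>
  also have "\<dots> \<le> v ^ Suc m * expect (\<lambda>xs. of_bool (E xs)) + B ^ m * e"
  proof -
    have "1 \<le> B" by (simp add: B)
    then have "v ^ m \<le> B ^ m" using v by (intro power_mono) auto
    then have "v ^ m * e \<le> B ^ m * e" using e by (rule mult_right_mono)
    then show ?thesis by (simp add: algebra_simps)
  qed
  finally show ?case unfolding E_def by (simp add: algebra_simps)
qed

section \<open>Strategies of the repeated game\<close>

text \<open>With the other coordinates fixed, the answers at \<open>i\<close> form a deterministic
  strategy for a single copy of \<open>G\<close>.\<close>

lemma winning_coordinate_le:
  assumes ans: "answering ans" and i: "i < n"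
  shows "expect (\<lambda>xs. of_bool (winning ans i xs)) \<le> game_value G"
proof -
  have "avg i (\<lambda>xs. of_bool (winning ans i xs)) xs \<le> game_value G" for xs
  proof -
    define f where "f = (\<lambda>j\<in>{..<players G}. \<lambda>u\<in>questions G j. ans j (xs(i := (\<lambda>_. u))) i)"
    have f: "f \<in> strategies G"
      using ans by (auto simp: f_def strategies_def answering_def)
    have "avg i (\<lambda>xs. of_bool (winning ans i xs)) xs = win_prob G f"
      unfolding avg_mean win_prob_eq_mean
    proof (intro mean_cong arg_cong[of _ _ of_bool])
      fix s assume s: "s \<in> set_pmf (distr_questions G)"
      have "(\<lambda>j\<in>{..<players G}. ans j (xs(i := s)) i) = (\<lambda>j\<in>{..<players G}. f j (s j))"
      proof (rule restrict_ext)
        fix j assume "j \<in> {..<players G}"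
        then have j: "j < players G" by simp
        have "ans j (xs(i := s)) = ans j (xs(i := (\<lambda>_. s j)))"
          by (rule answering_cong[OF ans j]) simp
        then show "ans j (xs(i := s)) i = f j (s j)"
          using j question_in_questions[OF s j] by (simp add: f_def)
      qed
      then show "winning ans i (xs(i := s)) = wins G s (\<lambda>j\<in>{..<players G}. f j (s j))"
        by (simp add: winning_def)
    qed
    then show ?thesis using win_prob_le_game_value[OF f] by simp
  qed
  then have "expect (avg i (\<lambda>xs. of_bool (winning ans i xs))) \<le> expect (\<lambda>_. game_value G)"
    by (intro expect_mono) auto
  then show ?thesis using i by (simp add: expect_avg)
qed

text \<open>A strategy of the repeated game is made total with default answers, which does not matter on
  the support.\<close>

lemma repeated_win_prob:
  assumes f: "f \<in> strategies (repeated_game G n)"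
  obtains ans where "answering ans"
    "win_prob (repeated_game G n) f = expect (\<lambda>xs. of_bool (all_winning ans xs))"
proof -
  define vec where "vec = (\<lambda>j xs. \<lambda>i\<in>{..<n}. (xs :: nat \<Rightarrow> nat \<Rightarrow> 'q) i j)"
  define ans where "ans = (\<lambda>j xs i. if f j (vec j xs) i \<in> answers G j then f j (vec j xs) i
    else (SOME b. b \<in> answers G j))"
  have vec: "vec j (xs(t := y)) = vec j (xs(t := z))" if "y j = z j" for j xs t y z
    using that by (auto simp: vec_def restrict_def fun_eq_iff)
  have ans: "answering ans"
    unfolding answering_def
  proof (intro conjI playerwiseI depends_atI allI impI)
    fix j t xs and y z :: "nat \<Rightarrow> 'q"
    assume "y j = z j"
    then have "vec j (xs(t := y)) = vec j (xs(t := z))" by (rule vec)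
    then show "ans j (xs(t := y)) = ans j (xs(t := z))" unfolding ans_def by (rule arg_cong)
  next
    fix j xs i assume "j < players G"
    then show "ans j xs i \<in> answers G j"
      using answers_nonempty[of j] by (auto simp: ans_def intro: someI_ex)
  qed
  have "win_prob (repeated_game G n) f = expect (\<lambda>xs. of_bool (\<forall>i<n. wins G
      (\<lambda>j\<in>{..<players G}. (\<lambda>j\<in>{..<players G}. vec j xs) j i)
      (\<lambda>j\<in>{..<players G}. (\<lambda>j\<in>{..<players G}. f j ((\<lambda>j\<in>{..<players G}. vec j xs) j)) j i)))"
    unfolding win_prob_def prob_eq_expectation expect_def
    by (simp only: repeated_game_def game.select_convs integral_map_pmf vec_def)
  also have "\<dots> = expect (\<lambda>xs. of_bool (all_winning ans xs))"
  proof (intro expect_cong arg_cong[of _ _ of_bool])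
    fix xs assume xs: "xs \<in> points"
    have "(\<lambda>j\<in>{..<players G}. (\<lambda>j\<in>{..<players G}. vec j xs) j i) = xs i" if i: "i < n" for i
    proof -
      have "xs i \<in> Pi\<^sub>E {..<players G} (questions G)"
        using xs i question_support_subset by (auto simp: points_def question_support_def)
      then show ?thesis using i by (auto simp: vec_def fun_eq_iff PiE_iff extensional_def)
    qed
    moreover have "(\<lambda>j\<in>{..<players G}. (\<lambda>j\<in>{..<players G}. f j ((\<lambda>j\<in>{..<players G}. vec j xs) j)) j i)
        = (\<lambda>j\<in>{..<players G}. ans j xs i)" if i: "i < n" for i
    proof (rule restrict_ext)
      fix j assume "j \<in> {..<players G}"
      then have j: "j < players G" by simp
      have "vec j xs \<in> {..<n} \<rightarrow>\<^sub>E questions G j"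
        using xs j question_in_questions by (auto simp: vec_def points_def)
      moreover have "f j \<in> ({..<n} \<rightarrow>\<^sub>E questions G j) \<rightarrow>\<^sub>E ({..<n} \<rightarrow>\<^sub>E answers G j)"
        using f j by (auto simp: strategies_def repeated_game_def)
      ultimately have "f j (vec j xs) i \<in> answers G j" using i by blast
      then show "(\<lambda>j\<in>{..<players G}. f j ((\<lambda>j\<in>{..<players G}. vec j xs) j)) j i = ans j xs i"
        using j by (simp add: ans_def)
    qed
    ultimately show "(\<forall>i<n. wins G
      (\<lambda>j\<in>{..<players G}. (\<lambda>j\<in>{..<players G}. vec j xs) j i)
      (\<lambda>j\<in>{..<players G}. (\<lambda>j\<in>{..<players G}. f j ((\<lambda>j\<in>{..<players G}. vec j xs) j)) j i))
      = all_winning ans xs"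
      unfolding all_winning_def winning_def by simp
  qed
  finally show thesis using that ans by blast
qed

end

section \<open>Value bounds and polynomial decay\<close>

context finite_game begin

text \<open>The first bound serves small \<open>n\<close>; the second leaves the number
  \<open>m\<close> of rounds free, to be chosen in terms of \<open>n\<close>.\<close>

lemma repeated_game_value_le:
  assumes "n > 0" and gap: "\<And>j. j < players G \<Longrightarrow> spectral_gap (\<lambda>z. z j) (others j) C" and C: "0 \<le> C"
  defines "k \<equiv> real (players G)"
    and "B \<equiv> real (card (set_pmf (distr_questions G)) * card answer_tuples)"
  shows "game_value (repeated_game G n) \<le> game_value G"
    and "game_value (repeated_game G n) \<le> game_value G ^ m
      + (1 + B) ^ m * ((k * B + 3 * k) * sqrt (2 * (B + 1) * (k * C) + k) * real n powr (- 1 / 4))"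
proof -
  interpret repeated_finite_game G n by unfold_locales (rule assms(1))
  interpret R: finite_game "repeated_game G n" by (rule finite_game_repeated)
  have "strategies (repeated_game G n) \<noteq> {}"
    using R.answers_nonempty by (auto simp: strategies_def PiE_eq_empty_iff)
  then have "game_value (repeated_game G n) \<in> win_prob (repeated_game G n) ` strategies (repeated_game G n)"
    unfolding game_value_def using R.finite_strategies by (intro Max_in) auto
  then obtain f where f: "f \<in> strategies (repeated_game G n)"
    and val: "game_value (repeated_game G n) = win_prob (repeated_game G n) f" by blast
  obtain ans where ans: "answering ans"
    and eq: "win_prob (repeated_game G n) f = expect (\<lambda>xs. of_bool (all_winning ans xs))"
    by (rule repeated_win_prob[OF f])
  have "expect (\<lambda>xs. of_bool (all_winning ans xs)) \<le> expect (\<lambda>xs. of_bool (winning ans 0 xs))"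
    using n_pos by (intro expect_mono) (auto simp: all_winning_def)
  also have "\<dots> \<le> game_value G" using ans n_pos by (rule winning_coordinate_le)
  finally show "game_value (repeated_game G n) \<le> game_value G" by (simp add: val eq)
  \<comment> \<open>The iteration starts from the full event, of probability 1.\<close>
  have triv: "playerwise (\<lambda>j xs. True)" by (intro playerwiseI depends_atI) simp
  have "expect (\<lambda>xs. of_bool ((\<forall>j<players G. (\<lambda>j xs. True) j xs) \<and> all_winning ans xs))
      \<le> game_value G ^ m * expect (\<lambda>xs. of_bool (\<forall>j<players G. (\<lambda>j xs. True) j xs))
        + (1 + B) ^ m * ((k * B + 3 * k) * sqrt (2 * (B + 1) * (k * C) + k) * real n powr (- 1 / 4))"
  proof (rule all_winning_le[OF _ ans _ _ _ _ triv])
    show "0 \<le> (k * B + 3 * k) * sqrt (2 * (B + 1) * (k * C) + k) * real n powr (- 1 / 4)"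
      using C by (simp add: k_def B_def)
  qed (use ex_lossy_coordinate[OF gap C _ ans] game_value_bounds in \<open>auto simp: k_def B_def\<close>)
  then show "game_value (repeated_game G n) \<le> game_value G ^ m
      + (1 + B) ^ m * ((k * B + 3 * k) * sqrt (2 * (B + 1) * (k * C) + k) * real n powr (- 1 / 4))"
    by (simp add: val eq)
qed

end

theorem theorem6p1:
  fixes G :: "('q, 'a) game"
  assumes "finite_game G"
    and "playerwise_connected G"
    and "game_value G < 1"
  shows "\<exists>c::real. c > 0 \<and>
    (\<forall>n::nat. n \<ge> 1 \<longrightarrow> game_value (repeated_game G n) \<le> real n powr (- c))"
proof -
  interpret finite_game G by (rule assms(1))
  obtain C where C: "C \<ge> 0" and gap: "\<And>j. j < players G \<Longrightarrow> spectral_gap (\<lambda>z. z j) (others j) C"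
    using ex_spectral_gap[OF assms(2)] by blast
  define k where "k = real (players G)"
  define B where "B = real (card (set_pmf (distr_questions G)) * card answer_tuples)"
  have "0 \<le> B" "0 \<le> k" by (simp_all add: B_def k_def)
  \<comment> \<open>The base \<open>1 + B\<close> is the factor by which the error grows in one
    round of the iteration.\<close>
  show ?thesis
  proof (rule polynomial_decay[where a = "1 / 4" and v = "game_value G" and B = "1 + B"
        and K = "(k * B + 3 * k) * sqrt (2 * (B + 1) * (k * C) + k)"])
    show "0 \<le> (k * B + 3 * k) * sqrt (2 * (B + 1) * (k * C) + k)"
      using C \<open>0 \<le> B\<close> \<open>0 \<le> k\<close> by simp
    show "1 \<le> 1 + B" using \<open>0 \<le> B\<close> by simp
    show "game_value (repeated_game G n) \<le> game_value G" if "n \<ge> 1" for n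
      by (rule repeated_game_value_le(1)[OF _ gap C]) (use that in auto)
    show "game_value (repeated_game G n) \<le> game_value G ^ m
        + (1 + B) ^ m * ((k * B + 3 * k) * sqrt (2 * (B + 1) * (k * C) + k) * real n powr (- (1 / 4)))"
      if "n \<ge> 1" for n m
      using repeated_game_value_le(2)[OF _ gap C, of n m] that by (simp add: k_def B_def)
  qed (use game_value_bounds assms(3) in auto)
qed

end
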